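(* For every $n, \ell \geq 1$, the problem $\mathsf{RT}^n_{<\infty, \ell}$ admits strong cone avoidance if and only if the problem $\mathsf{RT}^{n+1}_{<\infty, \ell}$ admits cone avoidance.
   Context: For $X \subseteq \omega$, $[X]^n$ denotes the set of $n$-element subsets of $X$ (identified with increasing $n$-tuples). For $n,\ell \geq 1$, $\mathsf{RT}^n_{<\infty,\ell}$ is the problem whose instances are colorings $f : [\omega]^n \to k$ for some $k \in \omega$, and whose solutions to $f$ are the infinite sets $H \subseteq \omega$ with $|f[H]^n| \leq \ell$. A problem $\mathsf{P}$ admits cone avoidance if for every pair of sets $C, Z$ with $C \not\leq_T Z$ and every $Z$-computable instance of $\mathsf{P}$ there is a solution $Y$ with $C \not\leq_T Y \oplus Z$. It admits strong cone avoidance if for every pair of sets $C,Z$ with $C \not\leq_T Z$ and every (arbitrary, not necessarily $Z$-computable) instance of $\mathsf{P}$ there is a solution $Y$ with $C \not\leq_T Y \oplus Z$. *)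

theory Defs
  imports "HOL-Library.Ramsey"
begin

subsection \<open>Relative computability\<close>

text \<open>Programs for partial recursive functions relative to a set of natural numbers. A program
  may be run on argument tuples of any length; applied to a tuple for which no evaluation rule
  fits, it diverges.\<close>

datatype prog =
    Zero
  | Succ
  | Proj nat
  | Query
  | Comp prog "prog list"
  | PrimRec prog prog
  | Mu prog

definition char_fun :: "nat set \<Rightarrow> nat \<Rightarrow> nat" where
  "char_fun A x = (if x \<in> A then 1 else 0)"

text \<open>\<open>computes Z e xs y\<close>: with access to \<open>Z\<close>, the program \<open>e\<close> halts on the arguments \<open>xs\<close>
  with value \<open>y\<close>.\<close>

inductive computes :: "nat set \<Rightarrow> prog \<Rightarrow> nat list \<Rightarrow> nat \<Rightarrow> bool" for Z where
  zero: "computes Z Zero xs 0"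
| succ: "computes Z Succ [x] (Suc x)"
| proj: "i < length xs \<Longrightarrow> computes Z (Proj i) xs (xs ! i)"
| query: "computes Z Query [x] (char_fun Z x)"
| comp: "list_all2 (\<lambda>g y. computes Z g xs y) gs ys \<Longrightarrow> computes Z f ys z
    \<Longrightarrow> computes Z (Comp f gs) xs z"
| primrec_0: "computes Z f xs y \<Longrightarrow> computes Z (PrimRec f g) (0 # xs) y"
| primrec_Suc: "computes Z (PrimRec f g) (m # xs) r \<Longrightarrow> computes Z g (m # r # xs) y
    \<Longrightarrow> computes Z (PrimRec f g) (Suc m # xs) y"
| mu: "computes Z f (m # xs) 0 \<Longrightarrow> (\<And>i. i < m \<Longrightarrow> \<exists>v. computes Z f (i # xs) (Suc v))
    \<Longrightarrow> computes Z (Mu f) xs m"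

inductive_cases zeroE: "computes Z Zero xs y"
inductive_cases succE: "computes Z Succ xs y"
inductive_cases projE: "computes Z (Proj i) xs y"
inductive_cases queryE: "computes Z Query xs y"
inductive_cases compE: "computes Z (Comp f gs) xs y"
inductive_cases pr0E: "computes Z (PrimRec f g) (0 # xs) y"
inductive_cases prSE: "computes Z (PrimRec f g) (Suc m # xs) y"
inductive_cases muE: "computes Z (Mu f) xs y"

lemma computes_deterministic:
  "computes Z e xs y \<Longrightarrow> computes Z e xs y' \<Longrightarrow> y = y'"
proof (induction arbitrary: y' rule: computes.induct)
  case (zero xs) then show ?case by (rule zeroE) simp
next
  case (succ x) then show ?case by (rule succE) simp
next
  case (proj i xs) from proj(2) show ?case by (rule projE) simp
next
  case (query x) then show ?case by (rule queryE) simp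
next
  case (comp xs gs ys f z)
  from comp.prems obtain ys' where ys': "list_all2 (\<lambda>g y. computes Z g xs y) gs ys'"
    and z: "computes Z f ys' y'"
    by (rule compE)
  have "ys = ys'"
    using comp.IH(1) ys' by (auto simp: list_all2_conv_all_nth intro: nth_equalityI)
  with z comp.IH(2) show ?case by simp
next
  case (primrec_0 f xs y g)
  from primrec_0.prems have "computes Z f xs y'" by (rule pr0E)
  then show ?case by (rule primrec_0.IH)
next
  case (primrec_Suc f g m xs r y)
  from primrec_Suc.prems obtain r' where r': "computes Z (PrimRec f g) (m # xs) r'"
    and y': "computes Z g (m # r' # xs) y'"
    by (rule prSE)
  have "r = r'" using r' by (rule primrec_Suc.IH(1))
  with y' show ?case using primrec_Suc.IH(2) by simp
next
  case (mu f m xs)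
  from mu.prems have m': "computes Z f (y' # xs) 0"
    and i: "\<And>i. i < y' \<Longrightarrow> \<exists>v. computes Z f (i # xs) (Suc v)"
    by (auto elim: muE)
  show ?case
  proof (rule linorder_cases[of m y'])
    assume "m < y'"
    with i mu.IH(1) show ?thesis by blast
  next
    assume "y' < m"
    with mu.IH(2) m' show ?thesis by blast
  qed
qed

definition turing_reducible :: "nat set \<Rightarrow> nat set \<Rightarrow> bool"  (infix \<open>\<le>\<^sub>T\<close> 50) where
  "A \<le>\<^sub>T B \<longleftrightarrow> (\<exists>e. \<forall>x. computes B e [x] (char_fun A x))"

definition turing_join :: "nat set \<Rightarrow> nat set \<Rightarrow> nat set"  (infixr \<open>\<oplus>\<^sub>T\<close> 65) where
  "A \<oplus>\<^sub>T B = {2 * x | x. x \<in> A} \<union> {2 * x + 1 | x. x \<in> B}"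

subsection \<open>Problems and cone avoidance\<close>

text \<open>The field \<open>computable_inst\<close> fixes the meaning of ``\<open>Z\<close>-computable instance'' for the given
  presentation of the instances. Solutions of non-instances are irrelevant.\<close>

record 'i problem =
  instances :: "'i set"
  computable_inst :: "nat set \<Rightarrow> 'i \<Rightarrow> bool"
  solutions :: "'i \<Rightarrow> nat set set"

definition cone_avoidance :: "'i problem \<Rightarrow> bool" where
  "cone_avoidance P \<longleftrightarrow>
    (\<forall>C Z. \<not> C \<le>\<^sub>T Z \<longrightarrow>
      (\<forall>I \<in> instances P. computable_inst P Z I \<longrightarrow>
        (\<exists>Y \<in> solutions P I. \<not> C \<le>\<^sub>T Y \<oplus>\<^sub>T Z)))"

definition strong_cone_avoidance :: "'i problem \<Rightarrow> bool" where
  "strong_cone_avoidance P \<longleftrightarrow>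
    (\<forall>C Z. \<not> C \<le>\<^sub>T Z \<longrightarrow>
      (\<forall>I \<in> instances P. \<exists>Y \<in> solutions P I. \<not> C \<le>\<^sub>T Y \<oplus>\<^sub>T Z))"

subsection \<open>Ramsey's theorem with several colours allowed\<close>

text \<open>A colouring of the \<open>n\<close>-element sets is computable if some program finds the colour from the
  increasing enumeration of the set; values of \<open>f\<close> on other sets, and the behaviour of the
  program on other tuples, play no role.\<close>

definition computable_colouring :: "nat \<Rightarrow> nat set \<Rightarrow> (nat set \<Rightarrow> nat) \<Rightarrow> bool" where
  "computable_colouring n Z f \<longleftrightarrow>
    (\<exists>e. \<forall>xs. length xs = n \<and> strict_sorted xs \<longrightarrow> computes Z e xs (f (set xs)))"

definition RT :: "nat \<Rightarrow> nat \<Rightarrow> (nat set \<Rightarrow> nat) problem" where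
  "RT n l = \<lparr>
     instances = {f. \<exists>k. f \<in> [UNIV]\<^bsup>n\<^esup> \<rightarrow> {..<k}},
     computable_inst = computable_colouring n,
     solutions = (\<lambda>f. {H. infinite H \<and> card (f ` [H]\<^bsup>n\<^esup>) \<le> l}) \<rparr>"

end

theory Submission
  imports Defs "HOL-Library.Nat_Bijection" "HOL-Library.Countable"
begin

text \<open>From strong cone avoidance for \<open>n\<close> to cone avoidance for \<open>n + 1\<close>: on a set \<open>A\<close> that is
  cohesive for the colour classes \<open>{y. f (s \<union> {y}) = c}\<close>, a colouring \<open>f\<close> of \<open>(n + 1)\<close>-sets has
  limits \<open>lim\<^bsub>y\<^esub> f (s \<union> {y})\<close>, and these form an arbitrary colouring of \<open>n\<close>-sets. A solution \<open>B \<subseteq> A\<close>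
  of the latter is thinned out computably until all colours are limit colours. Conversely, every
  colouring of \<open>n\<close>-sets is the limit of one of \<open>(n + 1)\<close>-sets that is computable from some \<open>G\<close> not
  helping to compute \<open>C\<close>.

  Both \<open>A\<close> and \<open>G\<close> are built by forcing with intervals \<open>{G. L \<subseteq> G \<subseteq> U}\<close> of sets, where \<open>L\<close> and \<open>U\<close>
  are \<open>Z\<close>-computable: the finite parts of members of such an interval are decidable from \<open>Z\<close>, so a
  functional that computes \<open>C\<close> from every member would make \<open>C\<close> computable from \<open>Z\<close>.\<close>

section \<open>Total recursive functions relative to an oracle\<close>

text \<open>Arguments are presented as an environment \<open>\<rho>\<close>, of which only \<open>\<rho> 0, \<dots>, \<rho> (n - 1)\<close>
  matter. A binder passes its bound variable as \<open>\<rho> 0\<close> and shifts the other variables.\<close>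

definition recf :: "nat set \<Rightarrow> nat \<Rightarrow> ((nat \<Rightarrow> nat) \<Rightarrow> nat) \<Rightarrow> bool" where
  "recf Z n f \<longleftrightarrow> (\<exists>e. \<forall>xs. length xs = n \<longrightarrow> computes Z e xs (f ((!) xs)))"

definition recp :: "nat set \<Rightarrow> nat \<Rightarrow> ((nat \<Rightarrow> nat) \<Rightarrow> bool) \<Rightarrow> bool" where
  "recp Z n P \<longleftrightarrow> recf Z n (\<lambda>\<rho>. of_bool (P \<rho>))"

lemma recf_cong:
  assumes "recf Z n f" and "\<And>\<rho>. f \<rho> = g \<rho>"
  shows "recf Z n g"
  using assms by (simp add: recf_def)

lemma recp_cong:
  assumes "recp Z n P" and "\<And>\<rho>. P \<rho> \<longleftrightarrow> Q \<rho>"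
  shows "recp Z n Q"
  using assms by (simp add: recp_def)

lemma turing_reducible_iff_recp: "A \<le>\<^sub>T Z \<longleftrightarrow> recp Z 1 (\<lambda>\<rho>. \<rho> 0 \<in> A)"
proof -
  have "of_bool (x \<in> A) = char_fun A x" for x
    by (simp add: char_fun_def)
  then show ?thesis
    by (force simp: turing_reducible_def recp_def recf_def length_Suc_conv)
qed

lemma recf_var: "i < n \<Longrightarrow> recf Z n (\<lambda>\<rho>. \<rho> i)"
  unfolding recf_def by (rule exI[of _ "Proj i"]) (auto intro: computes.proj)

lemma recf_comp:
  assumes f: "recf Z (length gs) f" and gs: "\<And>g. g \<in> set gs \<Longrightarrow> recf Z n g"
  shows "recf Z n (\<lambda>\<rho>. f ((!) (map (\<lambda>g. g \<rho>) gs)))"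
proof -
  obtain e where e: "\<And>xs. length xs = length gs \<Longrightarrow> computes Z e xs (f ((!) xs))"
    using f by (auto simp: recf_def)
  obtain p where p: "\<And>g xs. g \<in> set gs \<Longrightarrow> length xs = n \<Longrightarrow> computes Z (p g) xs (g ((!) xs))"
    using gs unfolding recf_def by metis
  show ?thesis
    unfolding recf_def
  proof (intro exI allI impI)
    fix xs :: "nat list" assume "length xs = n"
    then have "list_all2 (\<lambda>g y. computes Z g xs y) (map p gs) (map (\<lambda>g. g ((!) xs)) gs)"
      by (simp add: list_all2_conv_all_nth p)
    then show "computes Z (Comp e (map p gs)) xs (f ((!) (map (\<lambda>g. g ((!) xs)) gs)))"
      by (rule computes.comp) (simp add: e)
  qed
qed

text \<open>Reduces closure under a numeric operation to one program for the operation on its own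
  variables; the arithmetic rules below start from this form.\<close>

lemma recf_comp1:
  assumes "recf Z 1 (\<lambda>\<rho>. h (\<rho> 0))" and "recf Z n a"
  shows "recf Z n (\<lambda>\<rho>. h (a \<rho>))"
  using recf_comp[of Z "[a]" "\<lambda>\<rho>. h (\<rho> 0)" n] assms by simp

lemma recf_comp2:
  assumes "recf Z 2 (\<lambda>\<rho>. h (\<rho> 0) (\<rho> 1))" and "recf Z n a" and "recf Z n b"
  shows "recf Z n (\<lambda>\<rho>. h (a \<rho>) (b \<rho>))"
  using recf_comp[of Z "[a, b]" "\<lambda>\<rho>. h (\<rho> 0) (\<rho> 1)" n] assms
  by (auto simp: numeral_2_eq_2)

lemma recp_comp1:
  assumes "recp Z 1 (\<lambda>\<rho>. P (\<rho> 0))" and "recf Z n a"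
  shows "recp Z n (\<lambda>\<rho>. P (a \<rho>))"
  using assms unfolding recp_def by (rule recf_comp1)

lemma recp_comp2:
  assumes "recp Z 2 (\<lambda>\<rho>. P (\<rho> 0) (\<rho> 1))" and "recf Z n a" and "recf Z n b"
  shows "recp Z n (\<lambda>\<rho>. P (a \<rho>) (b \<rho>))"
  using assms unfolding recp_def by (rule recf_comp2)

text \<open>Weakening: composing with projections drops the first argument. This carries parameters
  under a binder, where the bound variable \<open>\<rho> 0\<close> has pushed the others up by
  one.\<close>

lemma recf_shift:
  assumes "recf Z n h"
  shows "recf Z (Suc n) (\<lambda>\<rho>. h (\<lambda>i. \<rho> (Suc i)))"
proof -
  obtain e where e: "\<And>xs. length xs = n \<Longrightarrow> computes Z e xs (h ((!) xs))"
    using assms by (auto simp: recf_def)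
  show ?thesis
    unfolding recf_def
  proof (intro exI allI impI)
    fix xs :: "nat list" assume xs: "length xs = Suc n"
    then have tl: "(\<lambda>i. xs ! Suc i) = (!) (tl xs)" by (cases xs) auto
    have "list_all2 (\<lambda>g y. computes Z g xs y) (map Proj [1..<Suc n]) (tl xs)"
      using xs by (auto simp: list_all2_conv_all_nth nth_tl intro!: computes.proj simp del: upt_Suc)
    then show "computes Z (Comp e (map Proj [1..<Suc n])) xs (h (\<lambda>i. xs ! Suc i))"
      unfolding tl by (rule computes.comp) (simp add: e xs)
  qed
qed

lemma recf_Suc:
  assumes "recf Z n a"
  shows "recf Z n (\<lambda>\<rho>. Suc (a \<rho>))"
proof (rule recf_comp1[OF _ assms])
  show "recf Z 1 (\<lambda>\<rho>. Suc (\<rho> 0))"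
    unfolding recf_def by (rule exI[of _ Succ]) (auto simp: length_Suc_conv intro: computes.succ)
qed

lemma recf_const: "recf Z n (\<lambda>\<rho>. c)"
proof (induction c)
  case 0
  show ?case unfolding recf_def by (rule exI[of _ Zero]) (auto intro: computes.zero)
next
  case (Suc c)
  then show ?case by (rule recf_Suc)
qed

text \<open>\<open>PrimRec\<close> recurses on its leading argument and hands counter and previous
  value to the step ahead of the parameters, hence the places 0 and 1 in \<open>g\<close> and the
  shift by two.\<close>

lemma recf_rec:
  assumes a: "recf Z n a" and f: "recf Z n f"
    and g: "recf Z (Suc (Suc n)) (\<lambda>\<rho>. g (\<rho> 0) (\<rho> 1) (\<lambda>i. \<rho> (Suc (Suc i))))"
  shows "recf Z n (\<lambda>\<rho>. rec_nat (f \<rho>) (\<lambda>m r. g m r \<rho>) (a \<rho>))"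
proof -
  obtain ea where ea: "\<And>xs. length xs = n \<Longrightarrow> computes Z ea xs (a ((!) xs))"
    using a by (auto simp: recf_def)
  obtain ef where ef: "\<And>xs. length xs = n \<Longrightarrow> computes Z ef xs (f ((!) xs))"
    using f by (auto simp: recf_def)
  obtain eg where eg: "\<And>m r xs. length xs = n \<Longrightarrow> computes Z eg (m # r # xs) (g m r ((!) xs))"
  proof -
    obtain e where e: "\<And>xs. length xs = Suc (Suc n) \<Longrightarrow>
        computes Z e xs (g (xs ! 0) (xs ! 1) (\<lambda>i. xs ! Suc (Suc i)))"
      using g by (auto simp: recf_def)
    show thesis
    proof (rule that)
      fix m r and xs :: "nat list" assume "length xs = n"
      with e[of "m # r # xs"] show "computes Z e (m # r # xs) (g m r ((!) xs))" by simp
    qed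
  qed
  show ?thesis
    unfolding recf_def
  proof (intro exI allI impI)
    fix xs :: "nat list" assume xs: "length xs = n"
    let ?ys = "a ((!) xs) # xs"
    have pr: "computes Z (PrimRec ef eg) (m # xs) (rec_nat (f ((!) xs)) (\<lambda>m r. g m r ((!) xs)) m)" for m
    proof (induction m)
      case 0
      then show ?case by (auto intro: computes.primrec_0 ef xs)
    next
      case (Suc m)
      then show ?case by (auto intro: computes.primrec_Suc eg xs)
    qed
    have "list_all2 (\<lambda>g y. computes Z g xs y) (map Proj [0..<n]) xs"
      using xs by (auto simp: list_all2_conv_all_nth intro!: computes.proj)
    then have "list_all2 (\<lambda>g y. computes Z g xs y) (ea # map Proj [0..<n]) ?ys"
      using ea xs by simp
    then show "computes Z (Comp (PrimRec ef eg) (ea # map Proj [0..<n])) xs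
        (rec_nat (f ((!) xs)) (\<lambda>m r. g m r ((!) xs)) (a ((!) xs)))"
      by (rule computes.comp) (rule pr)
  qed
qed

lemma recp_query: "recf Z n a \<Longrightarrow> recp Z n (\<lambda>\<rho>. a \<rho> \<in> Z)"
proof (rule recp_comp1[where P = "\<lambda>x. x \<in> Z"])
  have "char_fun Z x = of_bool (x \<in> Z)" for x
    by (simp add: char_fun_def)
  then have "computes Z Query [x] (of_bool (x \<in> Z))" for x
    using computes.query[of Z x] by simp
  then show "recp Z 1 (\<lambda>\<rho>. \<rho> 0 \<in> Z)"
    unfolding recp_def recf_def by (metis length_0_conv length_Suc_conv nth_Cons_0 One_nat_def)
qed

lemma recp_member: "A \<le>\<^sub>T Z \<Longrightarrow> recf Z n a \<Longrightarrow> recp Z n (\<lambda>\<rho>. a \<rho> \<in> A)"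
  unfolding turing_reducible_iff_recp by (rule recp_comp1)

subsection \<open>Arithmetic and bounded search\<close>

lemma recf_shift2: "recf Z n h \<Longrightarrow> recf Z (Suc (Suc n)) (\<lambda>\<rho>. h (\<lambda>i. \<rho> (Suc (Suc i))))"
  by (drule recf_shift, drule recf_shift) simp

lemma recf_pred: "recf Z n a \<Longrightarrow> recf Z n (\<lambda>\<rho>. a \<rho> - 1)"
proof (rule recf_comp1[where h = "\<lambda>x. x - 1"])
  have "recf Z 1 (\<lambda>\<rho>. rec_nat 0 (\<lambda>m r. m) (\<rho> 0))"
    by (rule recf_rec) (auto intro: recf_var recf_const)
  moreover have "rec_nat 0 (\<lambda>m r. m) x = x - 1" for x :: nat
    by (cases x) auto
  ultimately show "recf Z 1 (\<lambda>\<rho>. \<rho> 0 - 1)" by simp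
qed

lemma recf_add: "recf Z n a \<Longrightarrow> recf Z n b \<Longrightarrow> recf Z n (\<lambda>\<rho>. a \<rho> + b \<rho>)"
proof (rule recf_comp2[where h = "(+)"])
  have "recf Z 2 (\<lambda>\<rho>. rec_nat (\<rho> 1) (\<lambda>m r. Suc r) (\<rho> 0))"
    by (rule recf_rec) (intro recf_Suc recf_var; simp)+
  moreover have "rec_nat y (\<lambda>m r. Suc r) x = x + y" for x y :: nat
    by (induction x) auto
  ultimately show "recf Z 2 (\<lambda>\<rho>. \<rho> 0 + \<rho> 1)" by simp
qed

lemma recf_diff: "recf Z n a \<Longrightarrow> recf Z n b \<Longrightarrow> recf Z n (\<lambda>\<rho>. a \<rho> - b \<rho>)"
proof (rule recf_comp2[where h = "(-)"])
  have "recf Z 2 (\<lambda>\<rho>. rec_nat (\<rho> 0) (\<lambda>m r. r - 1) (\<rho> 1))"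
    by (rule recf_rec) (intro recf_pred recf_var; simp)+
  moreover have "rec_nat x (\<lambda>m r. r - 1) y = x - y" for x y :: nat
    by (induction y) auto
  ultimately show "recf Z 2 (\<lambda>\<rho>. \<rho> 0 - \<rho> 1)" by simp
qed

lemma recf_mult: "recf Z n a \<Longrightarrow> recf Z n b \<Longrightarrow> recf Z n (\<lambda>\<rho>. a \<rho> * b \<rho>)"
proof (rule recf_comp2[where h = "(*)"])
  have "recf Z 2 (\<lambda>\<rho>. rec_nat 0 (\<lambda>m r. r + \<rho> 1) (\<rho> 0))"
    by (rule recf_rec) (intro recf_add recf_const recf_var; simp)+
  moreover have "rec_nat 0 (\<lambda>m r. r + y) x = x * y" for x y :: nat
    by (induction x) auto
  ultimately show "recf Z 2 (\<lambda>\<rho>. \<rho> 0 * \<rho> 1)" by simp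
qed

lemma recf_power: "recf Z n a \<Longrightarrow> recf Z n b \<Longrightarrow> recf Z n (\<lambda>\<rho>. a \<rho> ^ b \<rho>)"
proof (rule recf_comp2[where h = "(^)"])
  have "recf Z 2 (\<lambda>\<rho>. rec_nat 1 (\<lambda>m r. \<rho> 0 * r) (\<rho> 1))"
    by (rule recf_rec) (intro recf_mult recf_const recf_var; simp)+
  moreover have "rec_nat 1 (\<lambda>m r. x * r) y = x ^ y" for x y :: nat
    by (induction y) auto
  ultimately show "recf Z 2 (\<lambda>\<rho>. \<rho> 0 ^ \<rho> 1)" by simp
qed

lemma recp_const: "recp Z n (\<lambda>\<rho>. b)"
  unfolding recp_def by (rule recf_const)

lemma recp_not: "recp Z n P \<Longrightarrow> recp Z n (\<lambda>\<rho>. \<not> P \<rho>)"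
  unfolding recp_def
  by (rule recf_cong[where f = "\<lambda>\<rho>. 1 - of_bool (P \<rho>)"]) (auto intro!: recf_diff recf_const)

lemma recp_conj: "recp Z n P \<Longrightarrow> recp Z n Q \<Longrightarrow> recp Z n (\<lambda>\<rho>. P \<rho> \<and> Q \<rho>)"
  unfolding recp_def of_bool_conj by (rule recf_mult)

lemma recp_disj: "recp Z n P \<Longrightarrow> recp Z n Q \<Longrightarrow> recp Z n (\<lambda>\<rho>. P \<rho> \<or> Q \<rho>)"
  by (rule recp_cong[where P = "\<lambda>\<rho>. \<not> (\<not> P \<rho> \<and> \<not> Q \<rho>)"]) (intro recp_not recp_conj, assumption+, blast)

lemma recp_imp: "recp Z n P \<Longrightarrow> recp Z n Q \<Longrightarrow> recp Z n (\<lambda>\<rho>. P \<rho> \<longrightarrow> Q \<rho>)"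
  by (rule recp_cong[where P = "\<lambda>\<rho>. \<not> P \<rho> \<or> Q \<rho>"]) (intro recp_not recp_disj, assumption+, blast)

lemma recp_le: "recf Z n a \<Longrightarrow> recf Z n b \<Longrightarrow> recp Z n (\<lambda>\<rho>. a \<rho> \<le> b \<rho>)"
  unfolding recp_def
  by (rule recf_cong[where f = "\<lambda>\<rho>. 1 - (a \<rho> - b \<rho>)"]) (auto intro!: recf_diff recf_const)

lemma recp_less: "recf Z n a \<Longrightarrow> recf Z n b \<Longrightarrow> recp Z n (\<lambda>\<rho>. a \<rho> < b \<rho>)"
  unfolding less_eq_Suc_le by (intro recp_le recf_Suc)

lemma recp_eq: "recf Z n a \<Longrightarrow> recf Z n b \<Longrightarrow> recp Z n (\<lambda>\<rho>. a \<rho> = b \<rho>)"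
  unfolding order_eq_iff by (intro recp_conj recp_le)

lemma recf_of_bool: "recp Z n P \<Longrightarrow> recf Z n (\<lambda>\<rho>. of_bool (P \<rho>))"
  unfolding recp_def .

lemma recf_if: "recp Z n P \<Longrightarrow> recf Z n a \<Longrightarrow> recf Z n b \<Longrightarrow> recf Z n (\<lambda>\<rho>. if P \<rho> then a \<rho> else b \<rho>)"
  by (rule recf_cong[where f = "\<lambda>\<rho>. of_bool (P \<rho>) * a \<rho> + of_bool (\<not> P \<rho>) * b \<rho>"])
    (auto intro!: recf_add recf_mult recf_of_bool recp_not)

text \<open>\<open>Mu\<close> stops at the first value 0, so the program handed to it decides the
  negation of \<open>P\<close>. A witness in every environment keeps the search total.\<close>

lemma recf_Least:
  assumes P: "recp Z (Suc n) (\<lambda>\<rho>. P (\<rho> 0) (\<lambda>i. \<rho> (Suc i)))" and ex: "\<And>\<rho>. \<exists>m. P m \<rho>"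
  shows "recf Z n (\<lambda>\<rho>. LEAST m. P m \<rho>)"
proof -
  have "recf Z (Suc n) (\<lambda>\<rho>. of_bool (\<not> P (\<rho> 0) (\<lambda>i. \<rho> (Suc i))))"
    using P by (intro recf_of_bool recp_not)
  then obtain e where e: "\<And>xs. length xs = Suc n \<Longrightarrow>
      computes Z e xs (of_bool (\<not> P (xs ! 0) (\<lambda>i. xs ! Suc i)))"
    by (auto simp: recf_def)
  have e': "computes Z e (m # xs) (of_bool (\<not> P m ((!) xs)))" if "length xs = n" for m xs
    using e[of "m # xs"] that by simp
  show ?thesis
    unfolding recf_def
  proof (intro exI allI impI)
    fix xs :: "nat list" assume xs: "length xs = n"
    let ?m = "LEAST m. P m ((!) xs)"
    have "P ?m ((!) xs)" using ex by (rule LeastI_ex)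
    then have "computes Z e (?m # xs) 0" using e'[OF xs, of ?m] by simp
    moreover have "\<exists>v. computes Z e (i # xs) (Suc v)" if "i < ?m" for i
      using not_less_Least[OF that] e'[OF xs, of i] by auto
    ultimately show "computes Z (Mu e) xs ?m" by (rule computes.mu)
  qed
qed

text \<open>Bounded quantification by unbounded search: look for the first \<open>i\<close> that
  reaches the bound or is a counterexample, and test whether it has reached the bound.\<close>

lemma recp_all_less:
  assumes b: "recf Z n b" and P: "recp Z (Suc n) (\<lambda>\<rho>. P (\<rho> 0) (\<lambda>i. \<rho> (Suc i)))"
  shows "recp Z n (\<lambda>\<rho>. \<forall>i < b \<rho>. P i \<rho>)"
proof (rule recp_cong)
  show "recp Z n (\<lambda>\<rho>. b \<rho> \<le> (LEAST i. b \<rho> \<le> i \<or> \<not> P i \<rho>))"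
    by (intro recp_le recf_Least recp_disj recp_not P b recf_shift recf_var) auto
  show "b \<rho> \<le> (LEAST i. b \<rho> \<le> i \<or> \<not> P i \<rho>) \<longleftrightarrow> (\<forall>i < b \<rho>. P i \<rho>)" for \<rho>
  proof -
    define m where "m = (LEAST i. b \<rho> \<le> i \<or> \<not> P i \<rho>)"
    have "b \<rho> \<le> m \<or> \<not> P m \<rho>" unfolding m_def by (rule LeastI[of _ "b \<rho>"]) simp
    moreover have "\<not> (b \<rho> \<le> i \<or> \<not> P i \<rho>)" if "i < m" for i
      using that unfolding m_def by (rule not_less_Least)
    ultimately have "b \<rho> \<le> m \<longleftrightarrow> (\<forall>i < b \<rho>. P i \<rho>)"
      by (meson linorder_not_less order_less_le_trans)
    then show ?thesis by (simp add: m_def)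
  qed
qed

lemma recp_ex_less:
  assumes "recf Z n b" and "recp Z (Suc n) (\<lambda>\<rho>. P (\<rho> 0) (\<lambda>i. \<rho> (Suc i)))"
  shows "recp Z n (\<lambda>\<rho>. \<exists>i < b \<rho>. P i \<rho>)"
  by (rule recp_cong[where P = "\<lambda>\<rho>. \<not> (\<forall>i < b \<rho>. \<not> P i \<rho>)"])
    (intro recp_not recp_all_less assms, blast)

text \<open>The index set is fixed in advance, so the conjunction is written out in the program and
  each \<open>P i\<close> may have a program of its own.\<close>

lemma recp_Ball: "finite S \<Longrightarrow> (\<And>i. i \<in> S \<Longrightarrow> recp Z n (P i)) \<Longrightarrow> recp Z n (\<lambda>\<rho>. \<forall>i \<in> S. P i \<rho>)"
  by (induction S rule: finite_induct) (auto intro: recp_const recp_conj)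

lemma recf_div:
  assumes "recf Z n a" and "recf Z n b" shows "recf Z n (\<lambda>\<rho>. a \<rho> div b \<rho>)"
proof (rule recf_comp2[OF _ assms])
  \<comment> \<open>The quotient is the least \<open>q\<close> with \<open>x < (q + 1) * y\<close>.
    For \<open>y = 0\<close> the first disjunct stops the search at 0, which is the value of
    division by zero.\<close>
  have "recf Z 2 (\<lambda>\<rho>. LEAST q. \<rho> 1 = 0 \<or> \<rho> 0 < Suc q * \<rho> 1)"
  proof (rule recf_Least)
    show "recp Z (Suc 2) (\<lambda>\<rho>. \<rho> (Suc 1) = 0 \<or> \<rho> (Suc 0) < Suc (\<rho> 0) * \<rho> (Suc 1))"
      by (intro recp_disj recp_eq recp_less recf_const recf_var recf_mult recf_Suc) auto
    show "\<exists>q. \<rho> 1 = 0 \<or> \<rho> 0 < Suc q * \<rho> 1" for \<rho> :: "nat \<Rightarrow> nat"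
      by (cases "\<rho> 1") (auto intro!: exI[of _ "\<rho> 0"])
  qed
  moreover have "(LEAST q. y = 0 \<or> x < Suc q * y) = x div y" for x y :: nat
  proof (rule Least_equality)
    show "y = 0 \<or> x < Suc (x div y) * y"
      using dividend_less_div_times[of y x] by (auto simp: add.commute)
    show "x div y \<le> q" if "y = 0 \<or> x < Suc q * y" for q
      using that by (cases "y = 0") (auto simp: less_mult_imp_div_less simp flip: less_Suc_eq_le)
  qed
  ultimately show "recf Z 2 (\<lambda>\<rho>. \<rho> 0 div \<rho> 1)" by simp
qed

lemma recp_even: "recf Z n a \<Longrightarrow> recp Z n (\<lambda>\<rho>. even (a \<rho>))"
  by (rule recp_cong[where P = "\<lambda>\<rho>. a \<rho> = 2 * (a \<rho> div 2)"])
    (intro recp_eq recf_mult recf_const recf_div, assumption+, metis dvd_triv_left dvd_mult_div_cancel)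

text \<open>Membership in a coded finite set is a binary digit of its code. This is how a number can
  serve as a finite oracle.\<close>

lemma recp_set_decode: "recf Z n a \<Longrightarrow> recf Z n b \<Longrightarrow> recp Z n (\<lambda>\<rho>. a \<rho> \<in> set_decode (b \<rho>))"
  unfolding set_decode_def mem_Collect_eq
  by (intro recp_not recp_even recf_div recf_power recf_const)

lemma recf_triangle: "recf Z n a \<Longrightarrow> recf Z n (\<lambda>\<rho>. triangle (a \<rho>))"
  unfolding triangle_def by (intro recf_div recf_mult recf_const recf_Suc)

lemma recf_prod_encode:
  "recf Z n a \<Longrightarrow> recf Z n b \<Longrightarrow> recf Z n (\<lambda>\<rho>. prod_encode (a \<rho>, b \<rho>))"
  by (simp add: prod_encode_def) (intro recf_add recf_triangle)

lemma recf_sum: "finite S \<Longrightarrow> (\<And>i. i \<in> S \<Longrightarrow> recf Z n (f i)) \<Longrightarrow> recf Z n (\<lambda>\<rho>. \<Sum>i\<in>S. f i \<rho>)"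
  by (induction S rule: finite_induct) (auto intro: recf_const recf_add)

subsection \<open>Turing reducibility\<close>

fun subst_oracle :: "prog \<Rightarrow> prog \<Rightarrow> prog" where
  "subst_oracle q Query = q"
| "subst_oracle q (Comp f gs) = Comp (subst_oracle q f) (map (subst_oracle q) gs)"
| "subst_oracle q (PrimRec f g) = PrimRec (subst_oracle q f) (subst_oracle q g)"
| "subst_oracle q (Mu f) = Mu (subst_oracle q f)"
| "subst_oracle q e = e"

text \<open>Wherever the run consults the oracle \<open>Z\<close>, the program \<open>q\<close>
  answers from \<open>W\<close>. Queries take exactly one argument, which is the case covered by the
  assumption on \<open>q\<close>.\<close>

lemma computes_subst_oracle:
  assumes q: "\<And>x. computes W q [x] (char_fun Z x)"
  shows "computes Z e xs y \<Longrightarrow> computes W (subst_oracle q e) xs y"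
proof (induction rule: computes.induct)
  case (comp xs gs ys f z)
  then show ?case
    by (auto intro!: computes.comp[where ys = ys] simp: list_all2_conv_all_nth)
next
  case (mu f m xs)
  then show ?case by (auto intro!: computes.mu)
qed (auto intro: computes.intros q)

lemma recf_oracle_mono: "recf Z n f \<Longrightarrow> Z \<le>\<^sub>T W \<Longrightarrow> recf W n f"
  unfolding recf_def turing_reducible_def by (meson computes_subst_oracle)

lemma recp_oracle_mono: "recp Z n P \<Longrightarrow> Z \<le>\<^sub>T W \<Longrightarrow> recp W n P"
  unfolding recp_def by (rule recf_oracle_mono)

lemma turing_reducible_trans: "A \<le>\<^sub>T B \<Longrightarrow> B \<le>\<^sub>T C \<Longrightarrow> A \<le>\<^sub>T C"
  using recp_oracle_mono turing_reducible_iff_recp by blast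

lemma turing_join_iff: "x \<in> A \<oplus>\<^sub>T B \<longleftrightarrow> (if even x then x div 2 \<in> A else x div 2 \<in> B)"
  by (auto simp: turing_join_def elim!: evenE oddE) presburger+

lemma turing_reducible_join1: "A \<le>\<^sub>T A \<oplus>\<^sub>T B"
  and turing_reducible_join2: "B \<le>\<^sub>T A \<oplus>\<^sub>T B"
proof -
  have "recp (A \<oplus>\<^sub>T B) 1 (\<lambda>\<rho>. 2 * \<rho> 0 \<in> A \<oplus>\<^sub>T B)" "recp (A \<oplus>\<^sub>T B) 1 (\<lambda>\<rho>. 2 * \<rho> 0 + 1 \<in> A \<oplus>\<^sub>T B)"
    by (intro recp_query recf_add recf_mult recf_const recf_var; simp)+
  then show "A \<le>\<^sub>T A \<oplus>\<^sub>T B" "B \<le>\<^sub>T A \<oplus>\<^sub>T B"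
    by (simp_all add: turing_reducible_iff_recp turing_join_iff)
qed

text \<open>Both sets may vary with the environment, so that a coded finite set can be joined with
  the oracle.\<close>

lemma recp_join:
  assumes "recp Z n (\<lambda>\<rho>. a \<rho> div 2 \<in> A \<rho>)" and "recp Z n (\<lambda>\<rho>. a \<rho> div 2 \<in> B \<rho>)" and "recf Z n a"
  shows "recp Z n (\<lambda>\<rho>. a \<rho> \<in> A \<rho> \<oplus>\<^sub>T B \<rho>)"
  unfolding turing_join_iff if_bool_eq_conj
  by (intro recp_conj recp_imp recp_not recp_even assms)

lemma turing_join_least: "A \<le>\<^sub>T C \<Longrightarrow> B \<le>\<^sub>T C \<Longrightarrow> A \<oplus>\<^sub>T B \<le>\<^sub>T C"
  unfolding turing_reducible_iff_recp[of "A \<oplus>\<^sub>T B"]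
  by (intro recp_join recp_member recf_div recf_const recf_var) auto

section \<open>Bounded evaluation of programs\<close>

text \<open>The number \<open>s\<close> bounds the oracle queries and the searches alike. The result is \<open>0\<close> if
  this bound does not suffice, and \<open>Suc y\<close> if the value is \<open>y\<close>.\<close>

primrec ev :: "nat set \<Rightarrow> nat \<Rightarrow> prog \<Rightarrow> nat list \<Rightarrow> nat" where
  "ev A s Zero = (\<lambda>xs. 1)"
| "ev A s Succ = (\<lambda>xs. if length xs = 1 then Suc (Suc (xs ! 0)) else 0)"
| "ev A s (Proj i) = (\<lambda>xs. if i < length xs then Suc (xs ! i) else 0)"
| "ev A s Query = (\<lambda>xs. if length xs = 1 \<and> xs ! 0 < s then Suc (char_fun A (xs ! 0)) else 0)"
| "ev A s (Comp f gs) = (\<lambda>xs.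
     if \<forall>h \<in> set (map (ev A s) gs). h xs \<noteq> 0
     then ev A s f (map (\<lambda>h. h xs - 1) (map (ev A s) gs)) else 0)"
| "ev A s (PrimRec f g) = (\<lambda>xs. case xs of [] \<Rightarrow> 0 | x # xs \<Rightarrow>
     rec_nat (ev A s f xs) (\<lambda>m r. if r = 0 then 0 else ev A s g (m # (r - 1) # xs)) x)"
| "ev A s (Mu f) = (\<lambda>xs. let m = (LEAST m. s \<le> m \<or> ev A s f (m # xs) \<le> 1) in
     if m < s \<and> ev A s f (m # xs) = 1 then Suc m else 0)"

lemma ev_sound:
  assumes "ev A s e xs = Suc y"
  shows "computes A e xs y"
  using assms
proof (induction e arbitrary: xs y)
  case Zero
  then show ?case by (auto intro: computes.zero)
next
  case Succ
  then show ?case by (auto split: if_splits simp: length_Suc_conv intro: computes.succ)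
next
  case (Proj i)
  then show ?case by (auto split: if_splits intro: computes.proj)
next
  case Query
  then show ?case
    by (auto split: if_splits simp: length_Suc_conv intro: computes.query)
next
  case (Comp f gs)
  have nz: "\<forall>g \<in> set gs. ev A s g xs \<noteq> 0"
    using Comp.prems by (auto split: if_splits)
  have "computes A f (map (\<lambda>g. ev A s g xs - 1) gs) y"
    using Comp.prems by (intro Comp.IH(1)) (auto split: if_splits simp: o_def)
  moreover have "list_all2 (\<lambda>g y. computes A g xs y) gs (map (\<lambda>g. ev A s g xs - 1) gs)"
    using nz by (auto simp: list_all2_conv_all_nth intro!: Comp.IH(2))
  ultimately show ?case by (rule computes.comp[rotated])
next
  case (PrimRec f g)
  then obtain x zs where xs: "xs = x # zs" by (cases xs) auto
  let ?r = "rec_nat (ev A s f zs) (\<lambda>m r. if r = 0 then 0 else ev A s g (m # (r - 1) # zs))"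
  have "?r x = Suc y \<Longrightarrow> computes A (PrimRec f g) (x # zs) y"
  proof (induction x arbitrary: y)
    case 0
    then show ?case by (auto intro: computes.primrec_0 PrimRec.IH)
  next
    case (Suc m)
    then have "?r m \<noteq> 0" by (auto split: if_splits)
    then obtain r where r: "?r m = Suc r" using not0_implies_Suc by blast
    then have "computes A (PrimRec f g) (m # zs) r" by (rule Suc.IH)
    moreover have "computes A g (m # r # zs) y" using Suc.prems r by (auto intro: PrimRec.IH)
    ultimately show ?case by (rule computes.primrec_Suc)
  qed
  then show ?case using PrimRec.prems xs by simp
next
  case (Mu f)
  \<comment> \<open>The search stops at the bound, at a failed evaluation (result 0) or at a zero of
    \<open>f\<close> (result 1); the final test in \<open>ev\<close> admits only the last case.
    Smaller arguments then have results at least 2, that is, positive values.\<close>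
  define m where "m = (LEAST m. s \<le> m \<or> ev A s f (m # xs) \<le> 1)"
  have m: "m < s" "ev A s f (m # xs) = 1" "y = m"
    using Mu.prems by (auto simp: m_def Let_def split: if_splits)
  have "computes A (Mu f) xs m"
  proof (rule computes.mu)
    show "computes A f (m # xs) 0" using m by (intro Mu.IH) simp
    fix i assume "i < m"
    then have "\<not> (s \<le> i \<or> ev A s f (i # xs) \<le> 1)"
      unfolding m_def by (rule not_less_Least)
    then obtain v where "ev A s f (i # xs) = Suc (Suc v)"
      by (auto simp: not_le dest!: less_imp_Suc_add)
    then show "\<exists>v. computes A f (i # xs) (Suc v)" by (blast intro: Mu.IH)
  qed
  then show ?case using m by simp
qed

text \<open>A halting run makes finitely many queries and searches. Truth for all large bounds
  passes from finitely many subcomputations to the whole, with no bookkeeping of maxima.\<close>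

lemma ev_complete:
  assumes "computes A e xs y"
  shows "eventually (\<lambda>s. ev A s e xs = Suc y) sequentially"
  using assms
proof (induction rule: computes.induct)
  case (query x)
  show ?case using eventually_gt_at_top[of x] by eventually_elim simp
next
  case (comp xs gs ys f z)
  have "eventually (\<lambda>s. \<forall>i \<in> {..<length gs}. ev A s (gs ! i) xs = Suc (ys ! i)) sequentially"
    using comp.IH(1) by (intro eventually_ball_finite) (auto simp: list_all2_conv_all_nth)
  with comp.IH(2) show ?case
  proof eventually_elim
    case (elim s)
    have len: "length gs = length ys" using comp.IH(1) by (rule list_all2_lengthD)
    have "map (\<lambda>g. ev A s g xs - 1) gs = ys"
      using elim len by (intro nth_equalityI) auto
    moreover have "\<forall>g \<in> set gs. ev A s g xs \<noteq> 0"
      using elim by (auto simp: in_set_conv_nth)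
    ultimately show ?case using elim by (simp add: o_def)
  qed
next
  case (primrec_Suc f g m xs r y)
  from primrec_Suc.IH show ?case by eventually_elim simp
next
  case (mu f m xs)
  have "eventually (\<lambda>s. ev A s f (i # xs) > 1) sequentially" if i: "i < m" for i
  proof -
    obtain v where "eventually (\<lambda>s. ev A s f (i # xs) = Suc (Suc v)) sequentially"
      using mu.IH(2)[OF i] by blast
    then show ?thesis by eventually_elim simp
  qed
  then have "eventually (\<lambda>s. \<forall>i \<in> {..<m}. ev A s f (i # xs) > 1) sequentially"
    by (intro eventually_ball_finite) auto
  with mu.IH(1) eventually_gt_at_top[of m] show ?case
  proof eventually_elim
    case (elim s)
    have "(LEAST m. s \<le> m \<or> ev A s f (m # xs) \<le> 1) = m"
    proof (rule Least_equality)
      show "m \<le> k" if "s \<le> k \<or> ev A s f (k # xs) \<le> 1" for k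
        using that elim by (meson lessThan_iff linorder_not_less order_less_le_trans less_imp_le)
    qed (use elim in simp)
    then show ?case using elim by simp
  qed
qed auto

text \<open>The use principle: bounded evaluation asks the oracle only about numbers below
  \<open>s\<close>.\<close>

lemma ev_cong:
  assumes "A \<inter> {..<s} = B \<inter> {..<s}"
  shows "ev A s e = ev B s e"
proof (induction e)
  case Query
  have "x \<in> A \<longleftrightarrow> x \<in> B" if "x < s" for x using assms that by blast
  then show ?case by (auto simp: fun_eq_iff char_fun_def)
next
  case (Comp f gs)
  then have "map (ev A s) gs = map (ev B s) gs" by simp
  with Comp show ?case by (simp only: ev.simps)
next
  case (PrimRec f g)
  then show ?case by (simp only: ev.simps)
next
  case (Mu f)
  then show ?case by (simp only: ev.simps)
qed auto

text \<open>No universal program is built: for each fixed \<open>e\<close>, induction on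
  \<open>e\<close> yields a program for its bounded evaluation. The oracle
  \<open>A (a \<rho>)\<close> is a parameter, decidable uniformly in its index, so that one can
  search through coded finite oracles.\<close>

lemma recf_ev:
  assumes A: "recp Z 2 (\<lambda>\<rho>. \<rho> 0 \<in> A (\<rho> 1))"
  shows "recf Z n s \<Longrightarrow> recf Z n a \<Longrightarrow> (\<And>h. h \<in> set hs \<Longrightarrow> recf Z n h) \<Longrightarrow>
    recf Z n (\<lambda>\<rho>. ev (A (a \<rho>)) (s \<rho>) e (map (\<lambda>h. h \<rho>) hs))"
proof (induction e arbitrary: n s a hs)
  case Zero
  show ?case by (simp add: recf_const)
next
  case Succ
  then show ?case by (cases "length hs = 1") (auto intro!: recf_Suc recf_const)
next
  case (Proj i)
  then show ?case by (cases "i < length hs") (auto intro!: recf_Suc recf_const)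
next
  case Query
  show ?case
  proof (cases "length hs = 1")
    case True
    then obtain h where h: "hs = [h]" by (auto simp: length_Suc_conv)
    then have rh: "recf Z n h" using Query by simp
    have "recp Z n (\<lambda>\<rho>. h \<rho> \<in> A (a \<rho>))"
      by (rule recp_comp2[OF A rh Query(2)])
    then have "recf Z n (\<lambda>\<rho>. if h \<rho> < s \<rho> then Suc (of_bool (h \<rho> \<in> A (a \<rho>))) else 0)"
      by (intro recf_if recp_less recf_Suc recf_of_bool recf_const rh Query)
    then show ?thesis by (rule recf_cong) (simp add: h char_fun_def)
  qed (simp add: recf_const)
next
  case (Comp f gs)
  let ?G = "\<lambda>g \<rho>. ev (A (a \<rho>)) (s \<rho>) g (map (\<lambda>h. h \<rho>) hs)"
  have G: "recf Z n (?G g)" if "g \<in> set gs" for g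
    using that Comp.prems by (intro Comp.IH(2))
  have "recf Z n (\<lambda>\<rho>. if \<forall>g \<in> set gs. ?G g \<rho> \<noteq> 0
      then ev (A (a \<rho>)) (s \<rho>) f (map (\<lambda>h. h \<rho>) (map (\<lambda>g \<rho>. ?G g \<rho> - 1) gs)) else 0)"
    using G Comp.prems
    by (intro recf_if recp_Ball recp_not recp_eq recf_const Comp.IH(1)) (auto intro: recf_pred[unfolded One_nat_def])
  then show ?case by (rule recf_cong) (auto simp: o_def)
next
  case (PrimRec f g)
  show ?case
  proof (cases hs)
    case Nil
    then show ?thesis by (simp add: recf_const)
  next
    case (Cons h hs')
    let ?G = "\<lambda>m r \<rho>. ev (A (a \<rho>)) (s \<rho>) g (m # r # map (\<lambda>h. h \<rho>) hs')"
    have "recf Z (Suc (Suc n)) (\<lambda>\<rho>. ev (A (a (\<lambda>i. \<rho> (Suc (Suc i))))) (s (\<lambda>i. \<rho> (Suc (Suc i)))) g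
      (map (\<lambda>h. h \<rho>) ((\<lambda>\<rho>. \<rho> 0) # (\<lambda>\<rho>. \<rho> 1 - 1) # map (\<lambda>h \<rho>. h (\<lambda>i. \<rho> (Suc (Suc i)))) hs')))"
      using PrimRec.prems Cons
      by (intro PrimRec.IH(2) recf_shift2) (auto intro!: recf_shift2 recf_var recf_pred[unfolded One_nat_def])
    then have "recf Z (Suc (Suc n)) (\<lambda>\<rho>. ?G (\<rho> 0) (\<rho> 1 - 1) (\<lambda>i. \<rho> (Suc (Suc i))))"
      by (rule recf_cong) (simp add: o_def)
    then have "recf Z n (\<lambda>\<rho>. rec_nat (ev (A (a \<rho>)) (s \<rho>) f (map (\<lambda>h. h \<rho>) hs'))
        (\<lambda>m r. if r = 0 then 0 else ?G m (r - 1) \<rho>) (h \<rho>))"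
      using PrimRec.prems Cons
      by (intro recf_rec recf_if recp_eq recf_const recf_var PrimRec.IH(1)) auto
    then show ?thesis by (rule recf_cong) (simp add: Cons)
  qed
next
  case (Mu f)
  let ?F = "\<lambda>m \<rho>. ev (A (a \<rho>)) (s \<rho>) f (m # map (\<lambda>h. h \<rho>) hs)"
  let ?m = "\<lambda>\<rho>. LEAST m. s \<rho> \<le> m \<or> ?F m \<rho> \<le> 1"
  have "recf Z (Suc n) (\<lambda>\<rho>. ev (A (a (\<lambda>i. \<rho> (Suc i)))) (s (\<lambda>i. \<rho> (Suc i))) f
    (map (\<lambda>h. h \<rho>) ((\<lambda>\<rho>. \<rho> 0) # map (\<lambda>h \<rho>. h (\<lambda>i. \<rho> (Suc i))) hs)))"
    using Mu.prems by (intro Mu.IH recf_shift) (auto intro!: recf_shift recf_var)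
  then have "recf Z (Suc n) (\<lambda>\<rho>. ?F (\<rho> 0) (\<lambda>i. \<rho> (Suc i)))"
    by (rule recf_cong) (simp add: o_def)
  then have m: "recf Z n ?m"
    by (intro recf_Least recp_disj recp_le recf_shift Mu.prems recf_var recf_const) auto
  have "recf Z n (\<lambda>\<rho>. ev (A (a \<rho>)) (s \<rho>) f (map (\<lambda>h. h \<rho>) (?m # hs)))"
    using Mu.prems m by (intro Mu.IH) auto
  then have F: "recf Z n (\<lambda>\<rho>. ?F (?m \<rho>) \<rho>)" by simp
  have "recf Z n (\<lambda>\<rho>. if ?m \<rho> < s \<rho> \<and> ?F (?m \<rho>) \<rho> = 1 then Suc (?m \<rho>) else 0)"
    by (intro recf_if recp_conj recp_less recp_eq recf_Suc recf_const m F Mu.prems(1))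
  then show ?case by (rule recf_cong) (simp add: Let_def)
qed

section \<open>Avoiding a cone by forcing with intervals\<close>

text \<open>The values of \<open>B\<close> on \<open>F\<close> are a finite table inside the
  program; elsewhere \<open>A\<close> is consulted.\<close>

lemma turing_reducible_finite_change:
  assumes A: "A \<le>\<^sub>T Z" and F: "finite F" and eq: "\<And>x. x \<notin> F \<Longrightarrow> x \<in> A \<longleftrightarrow> x \<in> B"
  shows "B \<le>\<^sub>T Z"
proof -
  have "recp Z 1 (\<lambda>\<rho>. (\<forall>d \<in> F. \<rho> 0 = d \<longrightarrow> d \<in> B) \<and> ((\<forall>d \<in> F. \<rho> 0 \<noteq> d) \<longrightarrow> \<rho> 0 \<in> A))"
    by (intro recp_conj recp_imp recp_Ball F recp_not recp_eq recp_const recf_const recf_var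
        recp_member A; simp)
  then show ?thesis
    unfolding turing_reducible_iff_recp by (rule recp_cong) (use eq in blast)
qed

lemma turing_reducible_finite: "finite F \<Longrightarrow> F \<le>\<^sub>T Z"
  by (rule turing_reducible_finite_change[of "{}"]) (simp_all add: turing_reducible_iff_recp recp_const)

text \<open>Bounds the search through all codes of subsets of an initial segment.\<close>

lemma set_encode_less_power:
  assumes "S \<subseteq> {..<n}"
  shows "set_encode S < 2 ^ n"
proof -
  have "set_encode S \<le> (\<Sum>i<n. 2 ^ i)"
    unfolding set_encode_def using assms by (intro sum_mono2) auto
  also have "\<dots> < 2 ^ n" by (induction n) auto
  finally show ?thesis .
qed

text \<open>If both alternatives failed, \<open>C\<close> could be computed by searching for a finite part of a set in
  the interval that makes \<open>e\<close> converge.\<close>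

lemma force_disagreement:
  assumes C: "\<not> C \<le>\<^sub>T Z" and L: "L \<le>\<^sub>T Z" and U: "U \<le>\<^sub>T Z" and LU: "L \<subseteq> U"
  obtains
    (wrong) x y H m where "L \<subseteq> H" "H \<subseteq> U" "y \<noteq> char_fun C x"
      "\<And>G. G \<inter> {..<m} = H \<inter> {..<m} \<Longrightarrow> computes (G \<oplus>\<^sub>T Z) e [x] y"
  | (never) x where "\<And>G. L \<subseteq> G \<Longrightarrow> G \<subseteq> U \<Longrightarrow> \<not> computes (G \<oplus>\<^sub>T Z) e [x] (char_fun C x)"
proof (rule ccontr)
  assume neither: "\<not> thesis"
  \<comment> \<open>\<open>V d s\<close>: below \<open>s\<close>, the set coded by \<open>d\<close>
    looks like a member of the interval.\<close>
  define V where "V d s \<longleftrightarrow> (\<forall>i<s. (i \<in> L \<longrightarrow> i \<in> set_decode d) \<and> (i \<in> set_decode d \<longrightarrow> i \<in> U))" for d s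
  define E where "E d s x = ev (set_decode d \<oplus>\<^sub>T Z) s e [x]" for d s x
  have ev_join_cong: "ev (G \<oplus>\<^sub>T Z) m e = ev (H \<oplus>\<^sub>T Z) m e" if "G \<inter> {..<m} = H \<inter> {..<m}" for G H m
  proof (rule ev_cong)
    have "x \<in> G \<longleftrightarrow> x \<in> H" if "x < m" for x using that \<open>G \<inter> {..<m} = H \<inter> {..<m}\<close> by blast
    then show "(G \<oplus>\<^sub>T Z) \<inter> {..<m} = (H \<oplus>\<^sub>T Z) \<inter> {..<m}" by (auto simp: turing_join_iff)
  qed
  have right: "y = char_fun C x" if V: "V d s" and E: "E d s x = Suc y" for d s x y
  proof (rule ccontr)
    assume ne: "y \<noteq> char_fun C x"
    \<comment> \<open>Any finite part allowed by \<open>V\<close> extends to a member of the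
      interval: continue it with \<open>L\<close> from \<open>s\<close> on. A wrong value would thus
      give the first alternative.\<close>
    define H where "H = (set_decode d \<inter> {..<s}) \<union> (L - {..<s})"
    have "computes (G \<oplus>\<^sub>T Z) e [x] y" if "G \<inter> {..<s} = H \<inter> {..<s}" for G
    proof (rule ev_sound)
      have "H \<inter> {..<s} = set_decode d \<inter> {..<s}" by (auto simp: H_def)
      then have "ev (G \<oplus>\<^sub>T Z) s e = ev (set_decode d \<oplus>\<^sub>T Z) s e"
        using that by (intro ev_join_cong) simp
      then show "ev (G \<oplus>\<^sub>T Z) s e [x] = Suc y" using E by (simp add: E_def)
    qed
    moreover have "L \<subseteq> H" "H \<subseteq> U" using V LU by (auto simp: H_def V_def)
    ultimately show False using neither wrong[of H y x s] ne by blast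
  qed
  \<comment> \<open>As the second alternative fails, some member computes the right value at
    \<open>x\<close>; its part below a sufficient bound is found by the search.\<close>
  have conv: "\<exists>s. \<exists>d < 2 ^ s. V d s \<and> E d s x \<noteq> 0" for x
  proof -
    obtain G where G: "L \<subseteq> G" "G \<subseteq> U" "computes (G \<oplus>\<^sub>T Z) e [x] (char_fun C x)"
      using neither never by blast
    obtain s where s: "ev (G \<oplus>\<^sub>T Z) s e [x] = Suc (char_fun C x)"
      using ev_complete[OF G(3)] by (auto simp: eventually_sequentially)
    let ?d = "set_encode (G \<inter> {..<s})"
    have "E ?d s x = Suc (char_fun C x)"
      using s ev_join_cong[of G s "G \<inter> {..<s}"] by (simp add: E_def)
    moreover have "V ?d s" using G by (auto simp: V_def)
    moreover have "?d < 2 ^ s" by (rule set_encode_less_power) simp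
    ultimately show ?thesis by (metis nat.distinct(1))
  qed
  \<comment> \<open>At stage \<open>t x\<close> some finite part converges, and by
    \<open>right\<close> every convergent result there is correct. Testing for the result
    \<open>Suc 1\<close> therefore decides \<open>C\<close>.\<close>
  define t where "t x = (LEAST s. \<exists>d < 2 ^ s. V d s \<and> E d s x \<noteq> 0)" for x
  have V: "recp Z n (\<lambda>\<rho>. V (a \<rho>) (b \<rho>))" if "recf Z n a" "recf Z n b" for n a b
    unfolding V_def using that
    by (intro recp_all_less recp_conj recp_imp recp_member recp_set_decode recf_shift recf_var L U) auto
  have E: "recf Z n (\<lambda>\<rho>. E (a \<rho>) (b \<rho>) (c \<rho>))" if "recf Z n a" "recf Z n b" "recf Z n c" for n a b c
  proof -
    have "recp Z 2 (\<lambda>\<rho>. \<rho> 0 \<in> set_decode (\<rho> 1) \<oplus>\<^sub>T Z)"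
      by (intro recp_join recp_set_decode recp_query recf_div recf_const recf_var) auto
    from recf_ev[OF this that(2,1), of "[c]" e] that(3) show ?thesis by (simp add: E_def)
  qed
  have t: "recf Z n (\<lambda>\<rho>. t (a \<rho>))" if "recf Z n a" for n a
    unfolding t_def using that conv
    by (intro recf_Least recp_ex_less recp_conj recp_not recp_eq V E recf_power recf_const recf_var
        recf_shift) auto
  have "recp Z 1 (\<lambda>\<rho>. \<exists>d < 2 ^ t (\<rho> 0). V d (t (\<rho> 0)) \<and> E d (t (\<rho> 0)) (\<rho> 0) = Suc 1)"
    by (intro recp_ex_less recp_conj recp_eq V E recf_power recf_const recf_var t) auto
  moreover have "(\<exists>d < 2 ^ t x. V d (t x) \<and> E d (t x) x = Suc 1) \<longleftrightarrow> x \<in> C" for x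
  proof
    assume "\<exists>d < 2 ^ t x. V d (t x) \<and> E d (t x) x = Suc 1"
    then have "1 = char_fun C x" using right by blast
    then show "x \<in> C" by (simp add: char_fun_def split: if_splits)
  next
    assume x: "x \<in> C"
    have "\<exists>d < 2 ^ t x. V d (t x) \<and> E d (t x) x \<noteq> 0"
      unfolding t_def using conv by (rule LeastI_ex)
    then obtain d y where d: "d < 2 ^ t x" "V d (t x)" "E d (t x) x = Suc y"
      using not0_implies_Suc by blast
    then have "y = 1" using right[OF d(2,3)] x by (simp add: char_fun_def)
    then show "\<exists>d < 2 ^ t x. V d (t x) \<and> E d (t x) x = Suc 1" using d by blast
  qed
  ultimately have "C \<le>\<^sub>T Z" by (simp add: turing_reducible_iff_recp)
  with C show False by simp
qed

section \<open>Generic sets from descending intervals\<close>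

instance prog :: countable
  by countable_datatype

text \<open>A descending sequence of intervals of the kind \<open>Q\<close> meets one requirement
  pair per stage: \<open>R i\<close>, and that program number \<open>i\<close> does not compute
  \<open>C\<close>. \<open>restrict\<close> says that the kind survives fixing finitely many
  memberships as in some member \<open>H\<close>; \<open>dense\<close> says that each
  \<open>R i\<close> can be forced.\<close>

lemma interval_forcing:
  assumes C: "\<not> C \<le>\<^sub>T Z" and ne: "\<exists>L U. Q L U"
    and cond: "\<And>L U. Q L U \<Longrightarrow> L \<subseteq> U \<and> L \<le>\<^sub>T Z \<and> U \<le>\<^sub>T Z"
    and restrict: "\<And>L U H m. Q L U \<Longrightarrow> L \<subseteq> H \<Longrightarrow> H \<subseteq> U \<Longrightarrow>
      Q (L \<union> (H \<inter> {..<m})) (U - ({..<m} - H))"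
    and dense: "\<And>L U i. Q L U \<Longrightarrow> \<exists>L' U'. Q L' U' \<and> L \<subseteq> L' \<and> U' \<subseteq> U \<and>
      (\<forall>G. L' \<subseteq> G \<longrightarrow> G \<subseteq> U' \<longrightarrow> R (i::nat) G)"
  obtains G where "\<not> C \<le>\<^sub>T G \<oplus>\<^sub>T Z" "\<And>i. R i G"
proof -
  define D where "D i G \<longleftrightarrow> R i G \<and> (\<exists>x. \<not> computes (G \<oplus>\<^sub>T Z) (from_nat i) [x] (char_fun C x))" for i G
  define below where "below c' c \<longleftrightarrow> case_prod Q c' \<and> fst c \<subseteq> fst c' \<and> snd c' \<subseteq> snd c"
    for c c' :: "nat set \<times> nat set"
  have step: "\<exists>c'. below c' c \<and> (\<forall>G. fst c' \<subseteq> G \<longrightarrow> G \<subseteq> snd c' \<longrightarrow> D i G) \<and> snd c' \<inter> {..<i} \<subseteq> fst c'"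
    if Q0: "case_prod Q c" for c i
  proof -
    obtain L U where LU: "Q L U" "fst c \<subseteq> L" "U \<subseteq> snd c"
        "\<And>G. L \<subseteq> G \<Longrightarrow> G \<subseteq> U \<Longrightarrow> R i G"
      using dense[of "fst c" "snd c" i] Q0 by (auto simp: split_beta)
    obtain L1 U1 where LU1: "Q L1 U1" "L \<subseteq> L1" "U1 \<subseteq> U"
        "\<And>G. L1 \<subseteq> G \<Longrightarrow> G \<subseteq> U1 \<Longrightarrow> \<exists>x. \<not> computes (G \<oplus>\<^sub>T Z) (from_nat i) [x] (char_fun C x)"
    proof (rule force_disagreement[OF C, of L U "from_nat i"])
      fix x y H m assume H: "L \<subseteq> H" "H \<subseteq> U" "y \<noteq> char_fun C x"
        "\<And>G. G \<inter> {..<m} = H \<inter> {..<m} \<Longrightarrow> computes (G \<oplus>\<^sub>T Z) (from_nat i) [x] y"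
      show thesis
      proof (rule that[OF restrict[OF LU(1) H(1,2), of m]])
        \<comment> \<open>Members of the restricted interval agree with \<open>H\<close> below
          \<open>m\<close>, so they all share the wrong computation.\<close>
        fix G assume "L \<union> (H \<inter> {..<m}) \<subseteq> G" "G \<subseteq> U - ({..<m} - H)"
        then have "computes (G \<oplus>\<^sub>T Z) (from_nat i) [x] y" by (intro H(4)) auto
        then show "\<exists>x. \<not> computes (G \<oplus>\<^sub>T Z) (from_nat i) [x] (char_fun C x)"
          using H(3) computes_deterministic by blast
      qed auto
    next
      fix x assume "\<And>G. L \<subseteq> G \<Longrightarrow> G \<subseteq> U \<Longrightarrow> \<not> computes (G \<oplus>\<^sub>T Z) (from_nat i) [x] (char_fun C x)"
      then show thesis by (intro that[of L U]) (use LU in auto)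
    qed (use cond[OF LU(1)] in auto)
    \<comment> \<open>\<open>?L\<close> is just \<open>L1\<close>, written to match
      \<open>restrict\<close> with \<open>H = L1\<close>. Removing from \<open>U1\<close> what lies
      below \<open>i\<close> and outside \<open>L1\<close> settles membership below
      \<open>i\<close>.\<close>
    let ?L = "L1 \<union> (L1 \<inter> {..<i})" and ?U = "U1 - ({..<i} - L1)"
    have "Q ?L ?U" using cond[OF LU1(1)] by (intro restrict LU1) auto
    moreover have "D i G" if "?L \<subseteq> G" "G \<subseteq> ?U" for G
      unfolding D_def
    proof
      show "R i G" using that LU1 by (intro LU(4)) auto
      show "\<exists>x. \<not> computes (G \<oplus>\<^sub>T Z) (from_nat i) [x] (char_fun C x)"
        using that by (intro LU1(4)) auto
    qed
    ultimately show ?thesis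
      using LU LU1 by (intro exI[of _ "(?L, ?U)"]) (auto simp: below_def)
  qed
  obtain c0 where c0: "case_prod Q c0" using ne by auto
  obtain c where c: "\<And>i. case_prod Q (c i)" "\<And>i. below (c (Suc i)) (c i) \<and>
      (\<forall>G. fst (c (Suc i)) \<subseteq> G \<longrightarrow> G \<subseteq> snd (c (Suc i)) \<longrightarrow> D i G) \<and> snd (c (Suc i)) \<inter> {..<i} \<subseteq> fst (c (Suc i))"
    using dependent_nat_choice[of "\<lambda>_. case_prod Q" "\<lambda>i c c'. below c' c \<and>
      (\<forall>G. fst c' \<subseteq> G \<longrightarrow> G \<subseteq> snd c' \<longrightarrow> D i G) \<and> snd c' \<inter> {..<i} \<subseteq> fst c'"] c0 step
    by (metis below_def)
  \<comment> \<open>Each lower bound lies below each upper bound, as a comparison at the later of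
    the two stages shows. So the union of the lower bounds is a member of all the intervals.\<close>
  define G where "G = (\<Union>i. fst (c i))"
  have mono: "fst (c i) \<subseteq> fst (c j) \<and> snd (c j) \<subseteq> snd (c i)" if "i \<le> j" for i j
    using that
  proof (induction rule: dec_induct)
    case (step n)
    then show ?case using c(2)[of n] unfolding below_def by blast
  qed simp
  have LU: "fst (c i) \<subseteq> snd (c i)" for i
    using cond[of "fst (c i)" "snd (c i)"] c(1)[of i] by (simp add: split_beta)
  have "fst (c i) \<subseteq> snd (c j)" for i j
    using mono[of i "max i j"] mono[of j "max i j"] LU[of "max i j"] by fastforce
  then have G: "fst (c i) \<subseteq> G" "G \<subseteq> snd (c i)" for i
    by (auto simp: G_def)
  have D: "D i G" for i using c(2)[of i] G[of "Suc i"] by blast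
  show thesis
  proof (rule that)
    show "R i G" for i using D by (simp add: D_def)
    have "\<exists>x. \<not> computes (G \<oplus>\<^sub>T Z) e [x] (char_fun C x)" for e
      using D[of "to_nat e"] by (simp add: D_def)
    then show "\<not> C \<le>\<^sub>T G \<oplus>\<^sub>T Z" by (simp add: turing_reducible_def)
  qed
qed

section \<open>Cohesive sets avoiding a cone\<close>

text \<open>Mathias forcing with \<open>Z\<close>-computable reservoirs: the upper bound is cut down
  to its part inside or outside \<open>S i\<close>, whichever is infinite. The reductions of the
  \<open>S i\<close> to \<open>Z\<close> may be chosen separately for each \<open>i\<close>.\<close>

lemma exists_cohesive:
  assumes C: "\<not> C \<le>\<^sub>T Z" and S: "\<And>i. S i \<le>\<^sub>T Z"
  obtains A where "infinite A" "\<not> C \<le>\<^sub>T A \<oplus>\<^sub>T Z" "\<And>i::nat. finite (A \<inter> S i) \<or> finite (A - S i)"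
proof -
  define Q where "Q L U \<longleftrightarrow> finite L \<and> infinite U \<and> L \<subseteq> U \<and> U \<le>\<^sub>T Z" for L U :: "nat set"
  show thesis
  proof (rule interval_forcing[OF C, of Q "\<lambda>i A. (finite (A \<inter> S i) \<or> finite (A - S i)) \<and> (\<exists>x\<ge>i. x \<in> A)"])
    have "UNIV \<le>\<^sub>T Z" by (simp add: turing_reducible_iff_recp recp_const)
    then show "\<exists>L U. Q L U" by (intro exI[of _ "{}"] exI[of _ UNIV]) (simp add: Q_def)
    fix L U assume Q: "Q L U"
    then show "L \<subseteq> U \<and> L \<le>\<^sub>T Z \<and> U \<le>\<^sub>T Z" by (simp add: Q_def turing_reducible_finite)
    show "Q (L \<union> (H \<inter> {..<m})) (U - ({..<m} - H))" if "L \<subseteq> H" "H \<subseteq> U" for H m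
      unfolding Q_def
    proof (intro conjI)
      show "U - ({..<m} - H) \<le>\<^sub>T Z"
      proof (rule turing_reducible_finite_change)
        show "U \<le>\<^sub>T Z" using Q by (simp add: Q_def)
        show "finite {..<m}" by simp
      qed auto
    qed (use Q that in \<open>auto simp: Q_def\<close>)
    fix i
    obtain V where V: "V \<subseteq> U" "infinite V" "V \<le>\<^sub>T Z" "V \<inter> S i = {} \<or> V \<subseteq> S i"
    proof (cases "finite (U \<inter> S i)")
      case True
      have "recp Z 1 (\<lambda>\<rho>. \<rho> 0 \<in> U \<and> \<not> \<rho> 0 \<in> S i)"
        using Q by (intro recp_conj recp_not recp_member S recf_var) (auto simp: Q_def)
      moreover have "infinite (U - S i)"
        using True Q by (metis Q_def Un_Diff_Int finite_Un)
      ultimately show thesis by (intro that[of "U - S i"]) (auto simp: turing_reducible_iff_recp)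
    next
      case False
      have "recp Z 1 (\<lambda>\<rho>. \<rho> 0 \<in> U \<and> \<rho> 0 \<in> S i)"
        using Q by (intro recp_conj recp_not recp_member S recf_var) (auto simp: Q_def)
      with False show thesis by (intro that[of "U \<inter> S i"]) (auto simp: turing_reducible_iff_recp)
    qed
    \<comment> \<open>Putting some \<open>x\<close> beyond \<open>i\<close> into the lower bound at
      every stage makes the final set infinite.\<close>
    obtain x where x: "x \<ge> i" "x \<in> V"
      using V(2) by (meson finite_nat_set_iff_bounded not_le_imp_less)
    show "\<exists>L' U'. Q L' U' \<and> L \<subseteq> L' \<and> U' \<subseteq> U \<and> (\<forall>A. L' \<subseteq> A \<longrightarrow> A \<subseteq> U' \<longrightarrow>
        (finite (A \<inter> S i) \<or> finite (A - S i)) \<and> (\<exists>x\<ge>i. x \<in> A))"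
    proof (rule exI, rule exI, intro conjI allI impI)
      \<comment> \<open>The finite set \<open>L\<close> stays in the upper bound so that the new
        pair is an interval; it adds only finitely many exceptions to homogeneity for
        \<open>S i\<close>.\<close>
      have "L \<union> V \<le>\<^sub>T Z"
        by (rule turing_reducible_finite_change[OF V(3), of L]) (use Q in \<open>auto simp: Q_def\<close>)
      then show "Q (insert x L) (L \<union> V)" using Q V x by (auto simp: Q_def)
      fix A assume A: "insert x L \<subseteq> A" "A \<subseteq> L \<union> V"
      show "finite (A \<inter> S i) \<or> finite (A - S i)"
        using V(4)
      proof
        assume "V \<inter> S i = {}"
        then have "A \<inter> S i \<subseteq> L" using A by auto
        then show ?thesis using Q by (meson Q_def finite_subset)
      next
        assume "V \<subseteq> S i"
        then have "A - S i \<subseteq> L" using A by auto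
        then show ?thesis using Q by (meson Q_def finite_subset)
      qed
      show "\<exists>x\<ge>i. x \<in> A" using x A by auto
    qed (use Q V in \<open>auto simp: Q_def\<close>)
  next
    fix A
    assume A: "\<not> C \<le>\<^sub>T A \<oplus>\<^sub>T Z"
      "\<And>i. (finite (A \<inter> S i) \<or> finite (A - S i)) \<and> (\<exists>x\<ge>i. x \<in> A)"
    show thesis
    proof (rule that)
      show "infinite A" using A(2) by (simp add: infinite_nat_iff_unbounded_le)
    qed (use A in auto)
  qed
qed

section \<open>Arbitrary sets as limits\<close>

text \<open>A limit lemma for arbitrary \<open>A\<close>. Column \<open>a\<close> of
  \<open>G\<close> is eventually constant with value the truth of \<open>a \<in> A\<close>. A
  condition leaves each column undetermined almost everywhere or has fixed it almost everywhere at
  that value.\<close>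

lemma exists_limit_approximation:
  assumes C: "\<not> C \<le>\<^sub>T Z"
  obtains G where "\<not> C \<le>\<^sub>T G \<oplus>\<^sub>T Z"
    "\<And>a. eventually (\<lambda>y. prod_encode (a, y) \<in> G \<longleftrightarrow> a \<in> A) sequentially"
proof -
  define free where "free L U a \<longleftrightarrow> eventually (\<lambda>y. prod_encode (a, y) \<in> U - L) sequentially" for L U a
  define locked where "locked L U a \<longleftrightarrow> eventually (\<lambda>y. if a \<in> A then prod_encode (a, y) \<in> L
      else prod_encode (a, y) \<notin> U) sequentially" for L U a
  define Q where "Q L U \<longleftrightarrow> L \<subseteq> U \<and> L \<le>\<^sub>T Z \<and> U \<le>\<^sub>T Z \<and> (\<forall>a. free L U a \<or> locked L U a)" for L U
  \<comment> \<open>A column has only finitely many codes below \<open>m\<close>, so restricting an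
    interval below \<open>m\<close> leaves free columns free and locked columns locked.\<close>
  have large: "eventually (\<lambda>y. m \<le> prod_encode (a, y)) sequentially" for m a
    using eventually_ge_at_top[of m] by eventually_elim (rule order.trans[OF _ le_prod_encode_2])
  \<comment> \<open>The search for \<open>y\<close> is bounded because \<open>y\<close> is at most
    the code \<open>prod_encode (a, y)\<close>.\<close>
  have column: "recp Z 1 (\<lambda>\<rho>. \<exists>y < Suc (\<rho> 0). b \<le> y \<and> \<rho> 0 = prod_encode (a, y))" for a b
    by (intro recp_ex_less recp_conj recp_le recp_eq recf_prod_encode recf_Suc recf_const recf_var) auto
  show thesis
  proof (rule interval_forcing[OF C, of Q "\<lambda>a G. eventually (\<lambda>y. prod_encode (a, y) \<in> G \<longleftrightarrow> a \<in> A) sequentially"])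
    have "UNIV \<le>\<^sub>T Z" "{} \<le>\<^sub>T Z" by (simp_all add: turing_reducible_iff_recp recp_const)
    then show "\<exists>L U. Q L U"
      by (intro exI[of _ "{}"] exI[of _ UNIV]) (simp add: Q_def free_def)
    fix L U assume Q: "Q L U"
    then show "L \<subseteq> U \<and> L \<le>\<^sub>T Z \<and> U \<le>\<^sub>T Z" by (simp add: Q_def)
    show "Q (L \<union> (H \<inter> {..<m})) (U - ({..<m} - H))" (is "Q ?L ?U") if "L \<subseteq> H" "H \<subseteq> U" for H m
      unfolding Q_def
    proof (intro conjI allI)
      show "?L \<le>\<^sub>T Z"
        by (rule turing_reducible_finite_change[of L Z "{..<m}"]) (use Q in \<open>auto simp: Q_def\<close>)
      show "?U \<le>\<^sub>T Z"
        by (rule turing_reducible_finite_change[of U Z "{..<m}"]) (use Q in \<open>auto simp: Q_def\<close>)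
      fix a
      have "free L U a \<or> locked L U a" using Q by (simp add: Q_def)
      then show "free ?L ?U a \<or> locked ?L ?U a"
      proof (elim disj_forward)
        show "free ?L ?U a" if "free L U a"
          using that[unfolded free_def] large[of m a] unfolding free_def by eventually_elim auto
        show "locked ?L ?U a" if "locked L U a"
          using that[unfolded locked_def] large[of m a] unfolding locked_def by eventually_elim auto
      qed
    qed (use Q that in \<open>auto simp: Q_def\<close>)
    fix a
    have lock_decides: "eventually (\<lambda>y. prod_encode (a, y) \<in> G \<longleftrightarrow> a \<in> A) sequentially"
      if "locked L U a" "L \<subseteq> G" "G \<subseteq> U" for L U G
      using that(1) unfolding locked_def by eventually_elim (use that in \<open>auto split: if_splits\<close>)
    obtain L' U' where "Q L' U'" "L \<subseteq> L'" "U' \<subseteq> U" "locked L' U' a"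
    proof (cases "locked L U a")
      case True
      then show thesis using that Q by blast
    next
      case False
      then have "free L U a" using Q by (auto simp: Q_def)
      then obtain b where b: "\<And>y. b \<le> y \<Longrightarrow> prod_encode (a, y) \<in> U - L"
        by (auto simp: free_def eventually_sequentially)
      define K where "K = {prod_encode (a, y) |y. b \<le> y}"
      have K: "K \<le>\<^sub>T Z"
        unfolding turing_reducible_iff_recp using column[of b a]
        by (rule recp_cong) (auto simp: K_def less_Suc_eq_le le_prod_encode_2)
      \<comment> \<open>The undetermined tail \<open>K\<close> of column \<open>a\<close> is put in
        or left out as a whole. This uses a single bit of \<open>A\<close>, so both bounds remain
        computable from \<open>Z\<close> however complicated \<open>A\<close> is.\<close>
      let ?L = "if a \<in> A then L \<union> K else L" and ?U = "if a \<in> A then U else U - K"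
      have "recp Z 1 (\<lambda>\<rho>. \<rho> 0 \<in> L \<or> \<rho> 0 \<in> K)" "recp Z 1 (\<lambda>\<rho>. \<rho> 0 \<in> U \<and> \<not> \<rho> 0 \<in> K)"
        using Q K by (intro recp_conj recp_disj recp_not recp_member recf_var; simp add: Q_def)+
      then have LU: "L \<union> K \<le>\<^sub>T Z" "U - K \<le>\<^sub>T Z"
        by (simp_all add: turing_reducible_iff_recp)
      have lock: "locked ?L ?U a"
        unfolding locked_def using eventually_ge_at_top[of b]
        by eventually_elim (auto simp: K_def)
      have other: "free ?L ?U a' \<longleftrightarrow> free L U a'" "locked ?L ?U a' \<longleftrightarrow> locked L U a'" if "a' \<noteq> a" for a'
      proof -
        have "prod_encode (a', y) \<notin> K" for y using that by (auto simp: K_def)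
        then show "free ?L ?U a' \<longleftrightarrow> free L U a'" "locked ?L ?U a' \<longleftrightarrow> locked L U a'"
          by (auto simp: free_def locked_def)
      qed
      have "Q ?L ?U"
        unfolding Q_def
      proof (intro conjI allI)
        show "?L \<subseteq> ?U" using Q b by (auto simp: K_def Q_def)
        show "free ?L ?U a' \<or> locked ?L ?U a'" for a'
          using other[of a'] lock Q by (cases "a' = a") (auto simp: Q_def)
      qed (use LU Q in \<open>auto simp: Q_def\<close>)
      with lock show thesis by (intro that) auto
    qed
    with lock_decides show "\<exists>L' U'. Q L' U' \<and> L \<subseteq> L' \<and> U' \<subseteq> U \<and> (\<forall>G. L' \<subseteq> G \<longrightarrow> G \<subseteq> U' \<longrightarrow>
        eventually (\<lambda>y. prod_encode (a, y) \<in> G \<longleftrightarrow> a \<in> A) sequentially)"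
      by blast
  qed (rule that)
qed

section \<open>Colourings\<close>

text \<open>A conditional by arithmetic would run \<open>e\<close> even where it diverges. Here
  \<open>e\<close> is the step of a primitive recursion whose recursion argument is the truth value
  of \<open>P\<close>, so it runs only if \<open>P\<close> holds.\<close>

lemma recf_partial_if:
  assumes P: "recp Z n P"
    and e: "\<And>xs. length xs = n \<Longrightarrow> P ((!) xs) \<Longrightarrow> computes Z e xs (h ((!) xs))"
  shows "recf Z n (\<lambda>\<rho>. if P \<rho> then h \<rho> else 0)"
proof -
  obtain p where p: "\<And>xs. length xs = n \<Longrightarrow> computes Z p xs (of_bool (P ((!) xs)))"
    using P by (auto simp: recp_def recf_def)
  \<comment> \<open>The projections start at 2 to skip the counter and the previous value.\<close>
  let ?shift = "Comp e (map Proj [2..<Suc (Suc n)])"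
  show ?thesis
    unfolding recf_def
  proof (intro exI allI impI)
    fix xs :: "nat list" assume xs: "length xs = n"
    have run: "computes Z (PrimRec Zero ?shift) (of_bool (P ((!) xs)) # xs) (if P ((!) xs) then h ((!) xs) else 0)"
    proof (cases "P ((!) xs)")
      case True
      have "list_all2 (\<lambda>g y. computes Z g (0 # 0 # xs) y) (map Proj [2..<Suc (Suc n)]) xs"
        unfolding list_all2_conv_all_nth
      proof (intro conjI allI impI)
        fix i assume i: "i < length (map Proj [2..<Suc (Suc n)])"
        then have "computes Z (Proj (Suc (Suc i))) (0 # 0 # xs) ((0 # 0 # xs) ! Suc (Suc i))"
          by (intro computes.proj) (simp add: xs del: upt_Suc)
        with i show "computes Z (map Proj [2..<Suc (Suc n)] ! i) (0 # 0 # xs) (xs ! i)"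
          by (simp del: upt_Suc)
      qed (simp add: xs, arith)
      then have "computes Z ?shift (0 # 0 # xs) (h ((!) xs))"
        by (rule computes.comp) (rule e[OF xs True])
      then have "computes Z (PrimRec Zero ?shift) (Suc 0 # xs) (h ((!) xs))"
        by (rule computes.primrec_Suc[OF computes.primrec_0[OF computes.zero]])
      with True show ?thesis by simp
    next
      case False
      then show ?thesis by (auto intro: computes.primrec_0 computes.zero)
    qed
    have "list_all2 (\<lambda>g y. computes Z g xs y) (map Proj [0..<n]) xs"
      using xs by (auto simp: list_all2_conv_all_nth intro!: computes.proj)
    then have "list_all2 (\<lambda>g y. computes Z g xs y) (p # map Proj [0..<n]) (of_bool (P ((!) xs)) # xs)"
      using p[OF xs] by simp
    then show "computes Z (Comp (PrimRec Zero ?shift) (p # map Proj [0..<n])) xs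
        (if P ((!) xs) then h ((!) xs) else 0)"
      by (rule computes.comp) (rule run)
  qed
qed

lemma recp_strict_sorted:
  "(\<And>g. g \<in> set gs \<Longrightarrow> recf Z n g) \<Longrightarrow> recp Z n (\<lambda>\<rho>. strict_sorted (map (\<lambda>g. g \<rho>) gs))"
proof (induction gs)
  case Nil
  then show ?case by (simp add: recp_const)
next
  case (Cons g gs)
  then have "recp Z n (\<lambda>\<rho>. (\<forall>h \<in> set gs. g \<rho> < h \<rho>) \<and> strict_sorted (map (\<lambda>g. g \<rho>) gs))"
    by (intro recp_conj recp_Ball recp_less) auto
  then show ?case by (rule recp_cong) simp
qed

text \<open>A program for a colouring may diverge on tuples that are not increasing.\<close>

definition sorted_colour :: "(nat set \<Rightarrow> nat) \<Rightarrow> nat list \<Rightarrow> nat" where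
  "sorted_colour f xs = (if strict_sorted xs then f (set xs) else 0)"

lemma recf_sorted_colour:
  assumes f: "computable_colouring n Z f" and gs: "\<And>g. g \<in> set gs \<Longrightarrow> recf Z m g"
    and len: "length gs = n"
  shows "recf Z m (\<lambda>\<rho>. sorted_colour f (map (\<lambda>g. g \<rho>) gs))"
proof -
  obtain e where e: "\<And>xs. length xs = n \<Longrightarrow> strict_sorted xs \<Longrightarrow> computes Z e xs (f (set xs))"
    using f by (auto simp: computable_colouring_def)
  have id: "map ((!) xs) [0..<n] = xs" if "length xs = n" for xs :: "nat list"
    using that by (metis map_nth)
  have "recp Z n (\<lambda>\<rho>. strict_sorted (map (\<lambda>g. g \<rho>) (map (\<lambda>i \<rho>. \<rho> i) [0..<n])))"
    by (rule recp_strict_sorted) (auto intro: recf_var)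
  then have "recp Z n (\<lambda>\<rho>. strict_sorted (map \<rho> [0..<n]))"
    by (rule recp_cong) (simp add: o_def)
  then have "recf Z n (\<lambda>\<rho>. if strict_sorted (map \<rho> [0..<n]) then f (set (map \<rho> [0..<n])) else 0)"
    by (rule recf_partial_if[where e = e]) (simp add: id e del: set_map)
  then have "recf Z (length gs) (\<lambda>\<rho>. sorted_colour f (map \<rho> [0..<n]))"
    unfolding sorted_colour_def len .
  from recf_comp[OF this gs] show ?thesis by (simp add: id len)
qed

text \<open>For fixed \<open>n\<close> this is a nest of \<open>n\<close> bounded quantifiers. The
  induction peels off the last entry, since the bound variable follows the \<open>n\<close> entries
  of the shorter list in the environment.\<close>

lemma recp_all_lists:
  assumes "recp Z (n + m) (\<lambda>\<rho>. P (map \<rho> [0..<n]) (\<lambda>i. \<rho> (i + n)))" and "recf Z m b"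
  shows "recp Z m (\<lambda>\<rho>. \<forall>xs. length xs = n \<and> set xs \<subseteq> {..<b \<rho>} \<longrightarrow> P xs \<rho>)"
  using assms
proof (induction n arbitrary: m P b)
  case 0
  then show ?case by simp
next
  case (Suc n)
  have "recp Z (Suc m) (\<lambda>\<rho>. \<forall>xs. length xs = n \<and> set xs \<subseteq> {..<b (\<lambda>i. \<rho> (Suc i))} \<longrightarrow>
      P (xs @ [\<rho> 0]) (\<lambda>i. \<rho> (Suc i)))"
    using Suc.prems by (intro Suc.IH recf_shift) auto
  then have "recp Z m (\<lambda>\<rho>. \<forall>x < b \<rho>. \<forall>xs. length xs = n \<and> set xs \<subseteq> {..<b \<rho>} \<longrightarrow> P (xs @ [x]) \<rho>)"
    by (intro recp_all_less Suc.prems)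
  then show ?case by (rule recp_cong) (auto simp: length_Suc_conv_rev)
qed

lemma sorted_list_of_nset:
  fixes s :: "nat set"
  assumes "s \<in> [S]\<^bsup>n\<^esup>"
  shows "length (sorted_list_of_set s) = n" "set (sorted_list_of_set s) = s"
  using assms by (auto simp: nsets_def)

lemma sorted_colour_snoc:
  assumes "s \<in> [S]\<^bsup>n\<^esup>" and "\<And>x. x \<in> s \<Longrightarrow> x < y"
  shows "sorted_colour f (sorted_list_of_set s @ [y]) = f (insert y s)"
  using assms by (auto simp: sorted_colour_def sorted_wrt_append nsets_def)

lemma eventually_above_nset:
  fixes s :: "nat set"
  assumes "s \<in> [S]\<^bsup>n\<^esup>"
  shows "eventually (\<lambda>y. \<forall>x \<in> s. x < y) sequentially"
  using assms by (intro eventually_ball_finite) (auto simp: nsets_def eventually_gt_at_top)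

lemma nsets_Suc_split:
  fixes t :: "nat set"
  assumes "t \<in> [S]\<^bsup>Suc n\<^esup>"
  obtains s y where "s \<in> [S]\<^bsup>n\<^esup>" "y \<in> S" "\<And>x. x \<in> s \<Longrightarrow> x < y" "t = insert y s"
proof (rule that)
  have t: "finite t" "t \<noteq> {}" "t \<subseteq> S" "card t = Suc n" using assms by (auto simp: nsets_def)
  show "t - {Max t} \<in> [S]\<^bsup>n\<^esup>" using t by (auto simp: nsets_def)
  show "Max t \<in> S" using t Max_in by blast
  show "x < Max t" if "x \<in> t - {Max t}" for x
    using that t by (metis DiffD1 DiffD2 Max_ge insertCI order_le_neq_trans)
  show "t = insert (Max t) (t - {Max t})" using t by (simp add: insert_absorb)
qed

lemma insert_nset:
  fixes y :: nat
  assumes "s \<in> [S]\<^bsup>n\<^esup>" and "y \<in> S" and "\<And>x. x \<in> s \<Longrightarrow> x < y"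
  shows "insert y s \<in> [S]\<^bsup>Suc n\<^esup>" "Max (insert y s) = y" "insert y s - {y} = s"
proof -
  have "finite s" "y \<notin> s" using assms by (auto simp: nsets_def)
  then show "insert y s \<in> [S]\<^bsup>Suc n\<^esup>" "Max (insert y s) = y" "insert y s - {y} = s"
    using assms by (auto simp: nsets_def less_imp_le intro: Max_eqI)
qed

section \<open>Thinning to the limit colours\<close>

text \<open>Greedy selection: \<open>y\<close> in \<open>B\<close> is accepted if it forms only
  colours in \<open>I\<close> with the \<open>n\<close>-sets of earlier accepted elements. The test
  looks only at what was accepted below \<open>y\<close>, so the result is computable.\<close>

lemma computable_thinning:
  assumes f: "computable_colouring (Suc n) Z f" and B: "infinite B" and I: "finite I"
    and lim: "\<And>s. s \<in> [B]\<^bsup>n\<^esup> \<Longrightarrow> eventually (\<lambda>y. y \<in> B \<longrightarrow> f (insert y s) \<in> I) sequentially"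
  obtains H where "infinite H" "H \<le>\<^sub>T B \<oplus>\<^sub>T Z" "f ` [H]\<^bsup>Suc n\<^esup> \<subseteq> I"
proof -
  let ?W = "B \<oplus>\<^sub>T Z"
  define cond where "cond d y \<longleftrightarrow> y \<in> B \<and> (\<forall>xs. length xs = n \<and> set xs \<subseteq> {..<y} \<longrightarrow>
    strict_sorted xs \<and> (\<forall>i\<in>{..<n}. xs ! i \<in> set_decode d) \<longrightarrow> sorted_colour f (xs @ [y]) \<in> I)" for d y
  \<comment> \<open>Course-of-values recursion in one number: \<open>K y\<close> has the binary
    digits of \<open>H\<close> below \<open>y\<close>, and acceptance of \<open>y\<close> adds the
    digit \<open>2 ^ y\<close>.\<close>
  define K where "K = rec_nat 0 (\<lambda>y d. if cond d y then 2 ^ y + d else d)"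
  define H where "H = {y. cond (K y) y}"
  have fW: "computable_colouring (Suc n) ?W f"
    using f turing_reducible_join2[of Z B] unfolding computable_colouring_def turing_reducible_def
    by (meson computes_subst_oracle)
  have cond2: "recp ?W 2 (\<lambda>\<rho>. cond (\<rho> 0) (\<rho> 1))"
    unfolding cond_def
  proof (intro recp_conj recp_all_lists)
    show "recp ?W 2 (\<lambda>\<rho>. \<rho> 1 \<in> B)" "recf ?W 2 (\<lambda>\<rho>. \<rho> 1)"
      by (intro recp_member turing_reducible_join1 recf_var; simp)+
    \<comment> \<open>The environment holds the \<open>n\<close> entries of the list first, then the
      code \<open>d\<close> in place \<open>0 + n\<close> and the candidate \<open>y\<close> in
      place \<open>1 + n\<close>.\<close>
    have col: "recf ?W (n + 2) (\<lambda>\<rho>. sorted_colour f (map \<rho> [0..<n] @ [\<rho> (1 + n)]))"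
      using recf_sorted_colour[OF fW, of "map (\<lambda>i \<rho>. \<rho> i) [0..<n] @ [\<lambda>\<rho>. \<rho> (1 + n)]" "n + 2"]
      by (fastforce simp: o_def intro: recf_var)
    have "recp ?W (n + 2) (\<lambda>\<rho>. strict_sorted (map (\<lambda>g. g \<rho>) (map (\<lambda>i \<rho>. \<rho> i) [0..<n])))"
      by (rule recp_strict_sorted) (auto intro: recf_var)
    then have sorted: "recp ?W (n + 2) (\<lambda>\<rho>. strict_sorted (map \<rho> [0..<n]))"
      by (rule recp_cong) (simp add: o_def)
    have "recp ?W (n + 2) (\<lambda>\<rho>. strict_sorted (map \<rho> [0..<n]) \<and> (\<forall>i\<in>{..<n}. \<rho> i \<in> set_decode (\<rho> (0 + n)))
        \<longrightarrow> sorted_colour f (map \<rho> [0..<n] @ [\<rho> (1 + n)]) \<in> I)"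
      by (intro recp_imp recp_conj recp_Ball recp_set_decode recf_var sorted recp_member col
          turing_reducible_finite I; simp)
    then show "recp ?W (n + 2) (\<lambda>\<rho>. strict_sorted (map \<rho> [0..<n]) \<and>
        (\<forall>i\<in>{..<n}. map \<rho> [0..<n] ! i \<in> set_decode (\<rho> (0 + n)))
        \<longrightarrow> sorted_colour f (map \<rho> [0..<n] @ [\<rho> (1 + n)]) \<in> I)"
      by (rule recp_cong) simp
  qed
  have K: "recf ?W 1 (\<lambda>\<rho>. K (\<rho> 0))"
    unfolding K_def
    by (intro recf_rec recf_if recp_comp2[where P = cond, OF cond2] recf_add recf_power recf_const recf_var) auto
  have red: "H \<le>\<^sub>T ?W"
    unfolding turing_reducible_iff_recp H_def mem_Collect_eq
    by (intro recp_comp2[where P = cond, OF cond2] K recf_var) simp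
  have decode: "set_decode (K y) = H \<inter> {..<y}" for y
  proof (induction y)
    case 0
    then show ?case by (simp add: K_def)
  next
    case (Suc y)
    have "set_decode (K (Suc y)) = (if cond (K y) y then insert y (set_decode (K y)) else set_decode (K y))"
      using Suc by (simp add: K_def set_decode_plus_power_2)
    then show ?case using Suc by (auto simp: H_def less_Suc_eq)
  qed
  have H_iff: "y \<in> H \<longleftrightarrow> y \<in> B \<and> (\<forall>s \<in> [H \<inter> {..<y}]\<^bsup>n\<^esup>. f (insert y s) \<in> I)" for y
  proof -
    have "(\<forall>xs. length xs = n \<and> set xs \<subseteq> {..<y} \<longrightarrow> strict_sorted xs \<and> (\<forall>i\<in>{..<n}. xs ! i \<in> H \<inter> {..<y})
        \<longrightarrow> sorted_colour f (xs @ [y]) \<in> I) \<longleftrightarrow> (\<forall>s \<in> [H \<inter> {..<y}]\<^bsup>n\<^esup>. f (insert y s) \<in> I)"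
      (is "?lists \<longleftrightarrow> ?sets")
    proof
      assume ?lists
      show ?sets
      proof
        fix s assume s: "s \<in> [H \<inter> {..<y}]\<^bsup>n\<^esup>"
        then have "s \<subseteq> H \<inter> {..<y}" by (simp add: nsets_def)
        moreover have "sorted_list_of_set s ! i \<in> s" if "i < n" for i
          using sorted_list_of_nset[OF s] that nth_mem by metis
        ultimately have "sorted_colour f (sorted_list_of_set s @ [y]) \<in> I"
          using \<open>?lists\<close>[rule_format, of "sorted_list_of_set s"] sorted_list_of_nset[OF s] by auto
        moreover have "x < y" if "x \<in> s" for x using that \<open>s \<subseteq> H \<inter> {..<y}\<close> by auto
        ultimately show "f (insert y s) \<in> I" using sorted_colour_snoc[OF s] by metis
      qed
    next
      assume ?sets
      show ?lists
      proof (intro allI impI)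
        fix xs assume xs: "length xs = n \<and> set xs \<subseteq> {..<y}"
          "strict_sorted xs \<and> (\<forall>i\<in>{..<n}. xs ! i \<in> H \<inter> {..<y})"
        then have "distinct xs" by (simp add: strict_sorted_iff)
        then have s: "set xs \<in> [H \<inter> {..<y}]\<^bsup>n\<^esup>"
          using xs by (auto simp: nsets_def distinct_card in_set_conv_nth)
        moreover have "sorted_list_of_set (set xs) = xs"
          using xs by (simp add: strict_sorted_iff sorted_list_of_set_unique sorted_list_of_set.idem_if_sorted_distinct)
        moreover have "x < y" if "x \<in> set xs" for x using that xs by auto
        ultimately show "sorted_colour f (xs @ [y]) \<in> I"
          using \<open>?sets\<close> sorted_colour_snoc[OF s, of y f] by simp
      qed
    qed
    moreover have "y \<in> H \<longleftrightarrow> cond (K y) y" by (simp add: H_def)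
    ultimately show ?thesis by (simp only: cond_def decode)
  qed
  have HB: "H \<subseteq> B" using H_iff by blast
  have "infinite H"
  proof
    assume fin: "finite H"
    \<comment> \<open>A finite \<open>H\<close> has finitely many \<open>n\<close>-subsets, so their
      limits hold simultaneously from some point on; then almost all of \<open>B\<close> would be
      accepted.\<close>
    have "eventually (\<lambda>y. \<forall>s \<in> [H]\<^bsup>n\<^esup>. y \<in> B \<longrightarrow> f (insert y s) \<in> I) sequentially"
      using fin lim HB nsets_mono by (intro eventually_ball_finite finite_imp_finite_nsets) blast+
    then have "eventually (\<lambda>y. y \<in> B \<longrightarrow> y \<in> H) sequentially"
      by eventually_elim (meson H_iff inf_le1 nsets_mono subsetD)
    then obtain m where "\<And>y. m \<le> y \<Longrightarrow> y \<in> B \<Longrightarrow> y \<in> H"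
      by (auto simp: eventually_sequentially)
    then have "B - H \<subseteq> {..<m}" by (meson DiffD1 DiffD2 lessThan_iff not_le_imp_less subsetI)
    with fin B show False by (meson finite_Diff2 finite_lessThan finite_subset)
  qed
  moreover have "f ` [H]\<^bsup>Suc n\<^esup> \<subseteq> I"
  proof
    fix c assume "c \<in> f ` [H]\<^bsup>Suc n\<^esup>"
    then obtain t where t: "t \<in> [H]\<^bsup>Suc n\<^esup>" "c = f t" by blast
    obtain s y where s: "s \<in> [H]\<^bsup>n\<^esup>" "y \<in> H" "\<And>x. x \<in> s \<Longrightarrow> x < y" "t = insert y s"
      using nsets_Suc_split[OF t(1)] by blast
    then have "s \<in> [H \<inter> {..<y}]\<^bsup>n\<^esup>" by (auto simp: nsets_def)
    then show "c \<in> I" using s H_iff t by blast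
  qed
  ultimately show thesis using red by (intro that)
qed

section \<open>Limits along a cohesive set\<close>

text \<open>The enumeration of \<open>A\<close> is inverted by counting the elements of
  \<open>A\<close> below a given one, so membership in the image needs no search.\<close>

lemma enumerate_image_reducible:
  assumes A: "infinite A" and AW: "A \<le>\<^sub>T W" and HW: "H \<le>\<^sub>T W"
  shows "enumerate A ` H \<le>\<^sub>T W"
proof -
  define cnt where "cnt = rec_nat 0 (\<lambda>i r. if i \<in> A then Suc r else r)"
  have card: "cnt y = card (A \<inter> {..<y})" for y
  proof (induction y)
    case (Suc y)
    have "A \<inter> {..<Suc y} = (if y \<in> A then insert y (A \<inter> {..<y}) else A \<inter> {..<y})"
      by (auto simp: less_Suc_eq)
    then show ?case using Suc by (simp add: cnt_def)
  qed (simp add: cnt_def)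
  have cnt: "cnt (enumerate A m) = m" for m
  proof -
    have "A \<inter> {..<enumerate A m} = enumerate A ` {..<m}"
    proof (intro equalityI subsetI)
      fix x assume x: "x \<in> A \<inter> {..<enumerate A m}"
      then obtain j where "x = enumerate A j" using enumerate_Ex A by blast
      with x A show "x \<in> enumerate A ` {..<m}" by simp
    qed (use A enumerate_in_set in auto)
    then show ?thesis
      by (simp add: card card_image[OF inj_on_subset[OF inj_enumerate[OF A]]])
  qed
  have "recf W 1 (\<lambda>\<rho>. cnt (\<rho> 0))"
    unfolding cnt_def by (intro recf_rec recf_if recp_member AW recf_Suc recf_const recf_var) auto
  then have "recp W 1 (\<lambda>\<rho>. \<rho> 0 \<in> A \<and> cnt (\<rho> 0) \<in> H)"
    by (intro recp_conj recp_member AW HW recf_var) auto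
  moreover have "x \<in> A \<and> cnt x \<in> H \<longleftrightarrow> x \<in> enumerate A ` H" for x
  proof
    assume x: "x \<in> A \<and> cnt x \<in> H"
    then obtain j where "x = enumerate A j" using enumerate_Ex A by blast
    with x cnt show "x \<in> enumerate A ` H" by auto
  qed (use A enumerate_in_set cnt in auto)
  ultimately show ?thesis
    unfolding turing_reducible_iff_recp by (rule recp_cong)
qed

lemma exists_limits_on_cohesive:
  assumes C: "\<not> C \<le>\<^sub>T Z" and comp: "computable_colouring (Suc n) Z f"
    and f: "f \<in> [UNIV]\<^bsup>Suc n\<^esup> \<rightarrow> {..<k}"
  obtains A where "infinite A" "\<not> C \<le>\<^sub>T A \<oplus>\<^sub>T Z"
    "\<And>s. s \<in> [UNIV]\<^bsup>n\<^esup> \<Longrightarrow> \<exists>c<k. eventually (\<lambda>y. y \<in> A \<longrightarrow> f (insert y s) = c) sequentially"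
proof -
  \<comment> \<open>The class of those \<open>y\<close> that give colour \<open>c\<close> on top of
    the set with code \<open>a\<close>; it is empty if \<open>a\<close> does not code an
    \<open>n\<close>-set.\<close>
  define S where "S = (\<lambda>(a, c). {y. set_decode a \<in> [UNIV]\<^bsup>n\<^esup> \<and>
    sorted_colour f (sorted_list_of_set (set_decode a) @ [y]) = c})"
  have S: "S (a, c) \<le>\<^sub>T Z" for a c
  proof (cases "set_decode a \<in> [UNIV]\<^bsup>n\<^esup>")
    case True
    let ?xs = "sorted_list_of_set (set_decode a)"
    have "recf Z 1 (\<lambda>\<rho>. sorted_colour f (map (\<lambda>g. g \<rho>) (map (\<lambda>x \<rho>. x) ?xs @ [\<lambda>\<rho>. \<rho> 0])))"
      using sorted_list_of_nset(1)[OF True]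
      by (intro recf_sorted_colour[OF comp]) (auto intro: recf_const recf_var)
    then have "recp Z 1 (\<lambda>\<rho>. sorted_colour f (map (\<lambda>g. g \<rho>) (map (\<lambda>x \<rho>. x) ?xs @ [\<lambda>\<rho>. \<rho> 0])) = c)"
      by (intro recp_eq recf_const)
    then show ?thesis
      unfolding turing_reducible_iff_recp by (rule recp_cong) (simp add: S_def True o_def)
  next
    case False
    then show ?thesis by (simp add: S_def turing_reducible_finite)
  qed
  then have S': "S (prod_decode i) \<le>\<^sub>T Z" for i by (metis surj_pair)
  obtain A where A: "infinite A" "\<not> C \<le>\<^sub>T A \<oplus>\<^sub>T Z"
    "\<And>i. finite (A \<inter> S (prod_decode i)) \<or> finite (A - S (prod_decode i))"
    using exists_cohesive[where S = "\<lambda>i. S (prod_decode i)", OF C S'] by blast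
  have "\<exists>c<k. eventually (\<lambda>y. y \<in> A \<longrightarrow> f (insert y s) = c) sequentially" if s: "s \<in> [UNIV]\<^bsup>n\<^esup>" for s
  proof -
    \<comment> \<open>For \<open>y\<close> above \<open>s\<close>, membership in \<open>T c\<close>
      means that \<open>insert y s\<close> has colour \<open>c\<close>; only finitely many
      \<open>y\<close> are not above \<open>s\<close>.\<close>
    define T where "T c = S (set_encode s, c)" for c
    have "finite s" using s by (simp add: nsets_def)
    then have T: "y \<in> T c \<longleftrightarrow> sorted_colour f (sorted_list_of_set s @ [y]) = c" for y c
      using s by (simp add: T_def S_def)
    have fin: "finite (A \<inter> T c) \<or> finite (A - T c)" for c
      using A(3)[of "prod_encode (set_encode s, c)"] by (simp add: T_def)
    have ev: "eventually (\<lambda>y. y \<notin> F) sequentially" if "finite F" for F :: "nat set"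
      using that by (meson eventually_sequentially finite_nat_set_iff_bounded not_le)
    note above = eventually_above_nset[OF s]
    show ?thesis
    proof (cases "\<exists>c<k. finite (A - T c)")
      case True
      then obtain c where c: "c < k" "finite (A - T c)" by blast
      have "eventually (\<lambda>y. y \<in> A \<longrightarrow> f (insert y s) = c) sequentially"
        using above ev[OF c(2)]
        by eventually_elim (use T sorted_colour_snoc[OF s] in auto)
      with c show ?thesis by blast
    next
      case False
      with fin have "finite (A \<inter> T c)" if "c < k" for c using that by blast
      then have "finite (\<Union>c<k. A \<inter> T c)" by blast
      from above ev[OF this] have "eventually (\<lambda>y. y \<notin> A) sequentially"
      proof eventually_elim
        case (elim y)
        have "f (insert y s) < k"
          using insert_nset(1)[OF s, of y] elim f by blast
        then show ?case using elim T sorted_colour_snoc[OF s, of y f] by auto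
      qed
      then have "finite A"
        by (metis eventually_sequentially finite_nat_set_iff_bounded not_le)
      with A show ?thesis by simp
    qed
  qed
  with A show thesis by (intro that)
qed

section \<open>The two implications\<close>

lemma cone_avoidance_RT_Suc:
  assumes "strong_cone_avoidance (RT n l)"
  shows "cone_avoidance (RT (Suc n) l)"
  unfolding cone_avoidance_def
proof (intro allI impI ballI)
  fix C Z f
  assume C: "\<not> C \<le>\<^sub>T Z" and "f \<in> instances (RT (Suc n) l)" and "computable_inst (RT (Suc n) l) Z f"
  then obtain k where f: "f \<in> [UNIV]\<^bsup>Suc n\<^esup> \<rightarrow> {..<k}" and comp: "computable_colouring (Suc n) Z f"
    by (auto simp: RT_def)
  obtain A where A: "infinite A" "\<not> C \<le>\<^sub>T A \<oplus>\<^sub>T Z"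
    "\<And>s. s \<in> [UNIV]\<^bsup>n\<^esup> \<Longrightarrow> \<exists>c<k. eventually (\<lambda>y. y \<in> A \<longrightarrow> f (insert y s) = c) sequentially"
    using exists_limits_on_cohesive[OF C comp f] by blast
  obtain lm where lm: "\<And>s. s \<in> [UNIV]\<^bsup>n\<^esup> \<Longrightarrow> lm s < k"
    "\<And>s. s \<in> [UNIV]\<^bsup>n\<^esup> \<Longrightarrow> eventually (\<lambda>y. y \<in> A \<longrightarrow> f (insert y s) = lm s) sequentially"
    using A(3) by metis
  \<comment> \<open>Instances live on all of \<nat>, whereas the limits are taken along
    \<open>A\<close>. Pulling \<open>lm\<close> back along the enumeration of \<open>A\<close> makes
    the image of any solution a subset of \<open>A\<close>.\<close>
  define g where "g s = lm (enumerate A ` s)" for s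
  have inj: "inj_on (enumerate A) X" for X
    using inj_enumerate[OF A(1)] by (rule inj_on_subset) simp
  have img: "enumerate A ` s \<in> [UNIV]\<^bsup>n\<^esup>" if "s \<in> [UNIV]\<^bsup>n\<^esup>" for s
    using that by (simp add: nsets_def card_image inj)
  have "g \<in> [UNIV]\<^bsup>n\<^esup> \<rightarrow> {..<k}" using lm(1) img by (simp add: g_def)
  then have "g \<in> instances (RT n l)" by (auto simp: RT_def)
  \<comment> \<open>\<open>g\<close> need not be computable from any of the oracles, which is why
    strong cone avoidance is used, here above \<open>A \<oplus>\<^sub>T Z\<close>.\<close>
  then obtain H0 where H0: "H0 \<in> solutions (RT n l) g" "\<not> C \<le>\<^sub>T H0 \<oplus>\<^sub>T (A \<oplus>\<^sub>T Z)"
    using assms A(2) unfolding strong_cone_avoidance_def by blast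
  let ?W = "H0 \<oplus>\<^sub>T (A \<oplus>\<^sub>T Z)"
  let ?B = "enumerate A ` H0" and ?I = "g ` [H0]\<^bsup>n\<^esup>"
  have I: "?I \<subseteq> {..<k}" using lm(1) img nsets_mono[of H0 UNIV n] by (auto simp: g_def)
  obtain H where H: "infinite H" "H \<le>\<^sub>T ?B \<oplus>\<^sub>T Z" "f ` [H]\<^bsup>Suc n\<^esup> \<subseteq> ?I"
  proof (rule computable_thinning[OF comp])
    show "infinite ?B" using H0(1) by (simp add: RT_def finite_image_iff inj)
    show "finite ?I" using I by (rule finite_subset) simp
    fix s assume s: "s \<in> [?B]\<^bsup>n\<^esup>"
    obtain s0 where s0: "s0 \<subseteq> H0" "s = enumerate A ` s0"
      using s by (auto simp: nsets_def subset_image_iff)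
    then have s0n: "s0 \<in> [H0]\<^bsup>n\<^esup>"
      using s by (simp add: nsets_def card_image inj finite_image_iff)
    have "s \<in> [UNIV]\<^bsup>n\<^esup>" using s by (simp add: nsets_def)
    from lm(2)[OF this] show "eventually (\<lambda>y. y \<in> ?B \<longrightarrow> f (insert y s) \<in> ?I) sequentially"
      by eventually_elim (use s0 s0n A(1) enumerate_in_set in \<open>auto simp: g_def\<close>)
  qed
  have AW: "A \<le>\<^sub>T ?W" and ZW: "Z \<le>\<^sub>T ?W"
    by (meson turing_reducible_join1 turing_reducible_join2 turing_reducible_trans)+
  have "?B \<le>\<^sub>T ?W"
    by (intro enumerate_image_reducible A AW turing_reducible_join1)
  then have "H \<oplus>\<^sub>T Z \<le>\<^sub>T ?W"
    using H(2) ZW by (meson turing_join_least turing_reducible_trans)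
  then have "\<not> C \<le>\<^sub>T H \<oplus>\<^sub>T Z"
    using H0(2) turing_reducible_trans by blast
  moreover have "H \<in> solutions (RT (Suc n) l) f"
  proof -
    \<comment> \<open>The thinned set shows only colours in \<open>?I\<close>, the limit colours on
      \<open>H0\<close>, of which there are at most \<open>l\<close>.\<close>
    have "card (f ` [H]\<^bsup>Suc n\<^esup>) \<le> card ?I"
      using H(3) I by (meson card_mono finite_lessThan finite_subset)
    with H(1) H0(1) show ?thesis by (simp add: RT_def)
  qed
  ultimately show "\<exists>Y \<in> solutions (RT (Suc n) l) f. \<not> C \<le>\<^sub>T Y \<oplus>\<^sub>T Z" by blast
qed

lemma strong_cone_avoidance_RT:
  assumes "cone_avoidance (RT (Suc n) l)"
  shows "strong_cone_avoidance (RT n l)"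
  unfolding strong_cone_avoidance_def
proof (intro allI impI ballI)
  fix C Z f
  assume C: "\<not> C \<le>\<^sub>T Z" and "f \<in> instances (RT n l)"
  then obtain k where f: "f \<in> [UNIV]\<^bsup>n\<^esup> \<rightarrow> {..<k}" by (auto simp: RT_def)
  \<comment> \<open>The graph of \<open>f\<close> under coding, to be approximated by the columns of
    \<open>G\<close>.\<close>
  define A where "A = {prod_encode (set_encode s, f s) |s. s \<in> [UNIV]\<^bsup>n\<^esup>}"
  have A: "prod_encode (set_encode s, c) \<in> A \<longleftrightarrow> c = f s" if "s \<in> [UNIV]\<^bsup>n\<^esup>" for s c
    using that by (auto simp: A_def nsets_def set_encode_eq)
  obtain G where G: "\<not> C \<le>\<^sub>T G \<oplus>\<^sub>T Z"
    "\<And>a. eventually (\<lambda>y. prod_encode (a, y) \<in> G \<longleftrightarrow> a \<in> A) sequentially"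
    using exists_limit_approximation[OF C, of A] by blast
  let ?W = "G \<oplus>\<^sub>T Z"
  \<comment> \<open>The guess at stage \<open>y\<close> for the colour of the set with code
    \<open>d\<close>. The disjunct \<open>k \<le> c\<close> ends the search with default
    \<open>k\<close> if no colour is approved, so \<open>g\<close> has up to \<open>k + 1\<close>
    colours.\<close>
  define h where "h d y = (LEAST c. k \<le> c \<or> prod_encode (prod_encode (d, c), y) \<in> G)" for d y
  define g where "g t = h (set_encode (t - {Max t})) (Max t)" for t
  have "h d y \<le> k" for d y unfolding h_def by (rule Least_le) simp
  then have bound: "g t < Suc k" for t by (simp add: g_def less_Suc_eq_le)
  have h: "recf ?W 2 (\<lambda>\<rho>. h (\<rho> 0) (\<rho> 1))"
    unfolding h_def
    by (intro recf_Least recp_disj recp_le recp_member turing_reducible_join1 recf_prod_encode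
        recf_const recf_var) auto
  \<comment> \<open>The sum is the code of the first \<open>n\<close> entries of an increasing
    tuple, and entry \<open>n\<close> is the maximum, which acts as the stage.\<close>
  have "recf ?W (Suc n) (\<lambda>\<rho>. h (\<Sum>i\<in>{..<n}. 2 ^ \<rho> i) (\<rho> n))"
    by (intro recf_comp2[where h = h, OF h] recf_sum recf_power recf_const recf_var) auto
  then obtain e where e: "\<And>xs. length xs = Suc n \<Longrightarrow>
      computes ?W e xs (h (\<Sum>i\<in>{..<n}. 2 ^ (xs ! i)) (xs ! n))"
    by (auto simp: recf_def)
  have "computable_colouring (Suc n) ?W g"
    unfolding computable_colouring_def
  proof (intro exI allI impI)
    fix xs :: "nat list" assume xs: "length xs = Suc n \<and> strict_sorted xs"
    then obtain ys y where ys: "xs = ys @ [y]" "length ys = n" by (auto simp: length_Suc_conv_rev)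
    have lt: "x < y" if "x \<in> set ys" for x using xs ys that by (simp add: sorted_wrt_append)
    have dist: "distinct ys" using xs ys by (simp add: strict_sorted_iff)
    have "set ys \<in> [UNIV]\<^bsup>n\<^esup>" using dist ys by (simp add: nsets_def distinct_card)
    note ins = insert_nset[OF this UNIV_I lt]
    have "set_encode (set ys) = (\<Sum>i\<in>{..<n}. 2 ^ (ys ! i))"
      using dist ys by (simp add: set_encode_def sum.distinct_set_conv_list sum_list_sum_nth atLeast0LessThan)
    also have "\<dots> = (\<Sum>i\<in>{..<n}. 2 ^ (xs ! i))"
      using ys by (intro sum.cong) (auto simp: nth_append)
    finally have "g (set xs) = h (\<Sum>i\<in>{..<n}. 2 ^ (xs ! i)) (xs ! n)"
      using ys ins by (simp add: g_def nth_append)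
    with e xs show "computes ?W e xs (g (set xs))" by simp
  qed
  then have "g \<in> instances (RT (Suc n) l)" "computable_inst (RT (Suc n) l) ?W g"
    using bound by (auto simp: RT_def)
  then obtain Y where Y: "Y \<in> solutions (RT (Suc n) l) g" "\<not> C \<le>\<^sub>T Y \<oplus>\<^sub>T ?W"
    using assms G(1) unfolding cone_avoidance_def by blast
  have infY: "infinite Y" using Y(1) by (simp add: RT_def)
  have "Y \<oplus>\<^sub>T Z \<le>\<^sub>T Y \<oplus>\<^sub>T ?W"
    by (meson turing_join_least turing_reducible_join1 turing_reducible_join2 turing_reducible_trans)
  then have "\<not> C \<le>\<^sub>T Y \<oplus>\<^sub>T Z" using Y(2) turing_reducible_trans by blast
  moreover have "f ` [Y]\<^bsup>n\<^esup> \<subseteq> g ` [Y]\<^bsup>Suc n\<^esup>"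
  proof
    fix c assume "c \<in> f ` [Y]\<^bsup>n\<^esup>"
    then obtain s where s: "s \<in> [Y]\<^bsup>n\<^esup>" "c = f s" by blast
    have sU: "s \<in> [UNIV]\<^bsup>n\<^esup>" using s nsets_mono[of Y UNIV] by blast
    \<comment> \<open>The guesses for the finitely many colours below \<open>k\<close> settle
      together. Any later \<open>y\<close> in \<open>Y\<close> above \<open>s\<close> then satisfies
      \<open>g (insert y s) = f s\<close>, so \<open>g\<close> shows on \<open>Y\<close> every
      colour that \<open>f\<close> does.\<close>
    have "eventually (\<lambda>y. \<forall>c\<in>{..<k}. prod_encode (prod_encode (set_encode s, c), y) \<in> G \<longleftrightarrow>
        prod_encode (set_encode s, c) \<in> A) sequentially"
      using G(2) by (intro eventually_ball_finite) auto
    then have "eventually (\<lambda>y. (\<forall>c\<in>{..<k}. prod_encode (prod_encode (set_encode s, c), y) \<in> G \<longleftrightarrow>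
        c = f s) \<and> (\<forall>x \<in> s. x < y)) sequentially"
      using eventually_above_nset[OF s(1)] by eventually_elim (simp add: A[OF sU])
    then obtain m where m: "\<And>y c. m \<le> y \<Longrightarrow> c < k \<Longrightarrow>
        prod_encode (prod_encode (set_encode s, c), y) \<in> G \<longleftrightarrow> c = f s" "\<And>y x. m \<le> y \<Longrightarrow> x \<in> s \<Longrightarrow> x < y"
      by (auto simp: eventually_sequentially)
    obtain y where y: "y \<in> Y" "m \<le> y"
      using infY by (meson infinite_nat_iff_unbounded_le)
    note ins = insert_nset[OF s(1) y(1) m(2)[OF y(2)]]
    have "f s < k" using f sU by blast
    then have "h (set_encode s) y = f s"
      unfolding h_def using m(1)[OF y(2)]
      by (intro Least_equality) (auto simp: leI intro: ccontr)
    then have "g (insert y s) = f s" using ins by (simp add: g_def)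
    with ins(1) s show "c \<in> g ` [Y]\<^bsup>Suc n\<^esup>" by (metis image_eqI)
  qed
  then have "card (f ` [Y]\<^bsup>n\<^esup>) \<le> card (g ` [Y]\<^bsup>Suc n\<^esup>)"
    by (rule card_mono[OF finite_subset[of _ "{..<Suc k}"], rotated -1]) (use bound in auto)
  then have "Y \<in> solutions (RT n l) f" using Y(1) by (simp add: RT_def)
  ultimately show "\<exists>Y \<in> solutions (RT n l) f. \<not> C \<le>\<^sub>T Y \<oplus>\<^sub>T Z" by blast
qed

theorem theorem1p5:
  fixes n l :: nat
  assumes "n \<ge> 1" and "l \<ge> 1"
  shows "strong_cone_avoidance (RT n l) \<longleftrightarrow> cone_avoidance (RT (n + 1) l)"
  using cone_avoidance_RT_Suc strong_cone_avoidance_RT by auto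

end
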